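(* Let $\mathcal{M}=\langle\mathcal{X},X_W,\Phi,\mathcal{B}\rangle$ be a system of constraints with $\mathcal{B}=\langle V,F,E\rangle$, and let $g:\mathcal{X}_W\to\mathcal{X}_{V\setminus W}$ be a solution of $\mathcal{M}$; let $X^*$ denote the random vector with $X^*_w=X_w$ ($w\in W$) and $X^*_{V\setminus W}=g(X_W)$. Suppose the subgraph of $\mathcal{B}$ induced by $(V\cup F)\setminus W$ has a perfect matching $M$. If for each strongly connected component $S$ of $\mathcal{G}(\mathcal{B},M)$ with $S\cap W=\emptyset$ the system $\mathcal{M}$ is uniquely solvable w.r.t. $S_F=(S\cup M(S))\cap F$ and $S_V=(S\cup M(S))\cap V$, then the pair $(\mathcal{G}(\mathcal{B},M)_{\mathrm{mar}(F)},\mathbb{P}_{X^*})$ satisfies the generalized directed global Markov property: for all subsets $A,B,C\subseteq V$, if $A$ and $B$ are $\sigma$-separated by $C$ in $\mathcal{G}(\mathcal{B},M)_{\mathrm{mar}(F)}$, then $X^*_A$ is independent of $X^*_B$ given $X^*_C$.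
   Context: System of constraints $\langle\mathcal{X},X_W,\Phi,\mathcal{B}\rangle$: $\mathcal{X}=\bigotimes_{v\in V}\mathcal{X}_v$, each $\mathcal{X}_v$ a standard measurable space; $W\subseteq V$ and $X_W=(X_w)_{w\in W}$ independent random variables; $\Phi=(\Phi_f)_{f\in F}$ with $\Phi_f=\langle\phi_f,c_f,V(f)\rangle$, $V(f)\subseteq V$, $c_f$ a constant in a standard measurable space $\mathcal{Y}$, $\phi_f:\mathcal{X}_{V(f)}\to\mathcal{Y}$ measurable; $\mathcal{B}=\langle V,F,E\rangle$ bipartite with $E=\{(f-v):v\in V(f)\}$; $V(S_F)=\bigcup_{f\in S_F}V(f)$. A solution is a measurable $g:\mathcal{X}_W\to\mathcal{X}_{V\setminus W}$ with $\phi_f(g_{V(f)\setminus W}(X_W),X_{V(f)\cap W})=c_f$ for all $f\in F$ a.s. $\mathcal{M}$ is uniquely solvable w.r.t. $S_F\subseteq F$ and $S_V\subseteq V(S_F)\setminus W$ if there is a measurable $g_{S_V}:\mathcal{X}_{V(S_F)\setminus S_V}\to\mathcal{X}_{S_V}$ such that, $\mathbb{P}_{X_W}$-a.s., for all $x_{V(S_F)\setminus W}$: $\phi_f(x_{V(f)\setminus W},X_{V(f)\cap W})=c_f$ for all $f\in S_F$ if and only if $x_{S_V}=g_{S_V}(x_{V(S_F)\setminus(S_V\cup W)},X_{V(S_F)\cap W})$. For a matching $M$ and vertex set $X$, $M(X)$ is the set of vertices matched to vertices of $X$. $\mathcal{G}(\mathcal{B},M)$ is the directed graph on $V\cup F$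 containing, for each $(v-f)\in E$, the edge $f\to v$ if $(v-f)\in M$ and $v\to f$ otherwise. For a directed graph and a set $U$ of vertices, the marginalization $\mathcal{G}_{\mathrm{mar}(U)}$ is the directed mixed graph on the remaining vertices with $x\to y$ iff there is a directed path from $x$ to $y$ all of whose intermediate vertices lie in $U$, and $x\leftrightarrow y$ iff there is a path $x\leftarrow u_1\leftarrow\dots\leftarrow u_i\to\dots\to u_k\to y$ with all $u_j\in U$. $\sigma$-separation in a directed mixed graph $\mathcal{G}$: paths are sequences of distinct vertices joined by edges $\to,\leftarrow,\leftrightarrow$; $\mathrm{an}(Z)$ is the set of vertices with a directed path (possibly trivial) into $Z$; $\mathrm{sc}(v)$ is the strongly connected component of $v$ (vertices that are both ancestors and descendants of $v$). A path $(v_1,\dots,v_n)$ is $\sigma$-blocked by $Z$ if (1) $v_1\in Z$ or $v_n\in Z$, or (2) some $v_i\notin\mathrm{an}(Z)$ has arrowheads of both adjacent path edges at $v_i$, or (3) some $v_i\in Z$ has $v_i\to v_{i+1}$ on the path with $v_{i+1}\notin\mathrm{sc}(v_i)$, or $v_{i-1}\leftarrow v_i$ with $v_{i-1}\notin\mathrm{sc}(v_i)$. $A$ and $B$ are $\sigma$-separated by $C$ if every path with one endpoint in $A$ and the other in $B$ is $\sigma$-blocked by $C$.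
   Formalization: The vertex sets V and F are assumed finite; for infinite V the claim fails (constraints x_n = x_{n+1} for all n, with the solution x_n = X_w for an exogenous w that is isolated in the graph). *)

theory Defs
  imports "HOL-Probability.Probability"
begin

definition polish_topology :: "'a topology \<Rightarrow> bool" where
  "polish_topology T \<longleftrightarrow> completely_metrizable_space T \<and> separable_space T"

definition standard_measurable_space :: "'a measure \<Rightarrow> bool" where
  "standard_measurable_space M \<longleftrightarrow>
     (\<exists>T. polish_topology T \<and> topspace T = space M \<and>
          sets M = sigma_sets (space M) {U. openin T U})"

definition cond_indep ::
  "'o measure \<Rightarrow> 'a measure \<Rightarrow> 'b measure \<Rightarrow> 'c measure \<Rightarrow>
   ('o \<Rightarrow> 'a) \<Rightarrow> ('o \<Rightarrow> 'b) \<Rightarrow> ('o \<Rightarrow> 'c) \<Rightarrow> bool" where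
  "cond_indep Q MA MB MC XA XB XC \<longleftrightarrow>
     (\<forall>A\<in>sets MA. \<forall>B\<in>sets MB.
        AE \<omega> in Q.
          real_cond_exp Q (vimage_algebra (space Q) XC MC)
             (indicator ((XA -` A \<inter> space Q) \<inter> (XB -` B \<inter> space Q))) \<omega>
          = real_cond_exp Q (vimage_algebra (space Q) XC MC)
               (indicator (XA -` A \<inter> space Q)) \<omega>
            * real_cond_exp Q (vimage_algebra (space Q) XC MC)
               (indicator (XB -` B \<inter> space Q)) \<omega>)"

text \<open>Vertices are of type \<open>'v\<close>, constraints (factors) of type \<open>'f\<close>;
all spaces \<open>\<X>_v\<close> take values in a common type \<open>'a\<close> and are given by
\<open>Xsp v\<close>; \<open>\<X>_S\<close> is the product \<open>PiM S Xsp\<close>.  The constraint space \<open>\<Y>\<close>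
is \<open>Ysp\<close>.  The random variables \<open>X w\<close> (\<open>w \<in> W\<close>) live on the probability
space \<open>P\<close>.\<close>

definition system_of_constraints ::
  "'o measure \<Rightarrow> ('v \<Rightarrow> 'a measure) \<Rightarrow> 'v set \<Rightarrow> 'v set \<Rightarrow> ('v \<Rightarrow> 'o \<Rightarrow> 'a) \<Rightarrow>
   'f set \<Rightarrow> ('f \<Rightarrow> 'v set) \<Rightarrow> ('f \<Rightarrow> ('v \<Rightarrow> 'a) \<Rightarrow> 'b) \<Rightarrow> ('f \<Rightarrow> 'b) \<Rightarrow> 'b measure \<Rightarrow> bool"
  where
  "system_of_constraints P Xsp V W X F Vf phi c Ysp \<longleftrightarrow>
     finite V \<and> finite F \<and> W \<subseteq> V \<and>
     (\<forall>v\<in>V. standard_measurable_space (Xsp v)) \<and>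
     standard_measurable_space Ysp \<and>
     prob_space P \<and> prob_space.indep_vars P Xsp X W \<and>
     (\<forall>f\<in>F. Vf f \<subseteq> V \<and> c f \<in> space Ysp \<and>
              phi f \<in> PiM (Vf f) Xsp \<rightarrow>\<^sub>M Ysp)"

definition XW :: "'v set \<Rightarrow> ('v \<Rightarrow> 'o \<Rightarrow> 'a) \<Rightarrow> 'o \<Rightarrow> ('v \<Rightarrow> 'a)" where
  "XW W X \<omega> = restrict (\<lambda>w. X w \<omega>) W"

definition combine :: "'v set \<Rightarrow> ('v \<Rightarrow> 'a) \<Rightarrow> ('v \<Rightarrow> 'a) \<Rightarrow> 'v set \<Rightarrow> ('v \<Rightarrow> 'a)" where
  "combine W x xw D = restrict (\<lambda>v. if v \<in> W then xw v else x v) D"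

definition is_solution ::
  "'o measure \<Rightarrow> ('v \<Rightarrow> 'a measure) \<Rightarrow> 'v set \<Rightarrow> 'v set \<Rightarrow> ('v \<Rightarrow> 'o \<Rightarrow> 'a) \<Rightarrow>
   'f set \<Rightarrow> ('f \<Rightarrow> 'v set) \<Rightarrow> ('f \<Rightarrow> ('v \<Rightarrow> 'a) \<Rightarrow> 'b) \<Rightarrow> ('f \<Rightarrow> 'b) \<Rightarrow>
   (('v \<Rightarrow> 'a) \<Rightarrow> ('v \<Rightarrow> 'a)) \<Rightarrow> bool" where
  "is_solution P Xsp V W X F Vf phi c g \<longleftrightarrow>
     g \<in> PiM W Xsp \<rightarrow>\<^sub>M PiM (V - W) Xsp \<and>
     (AE \<omega> in P. \<forall>f\<in>F. phi f (combine W (g (XW W X \<omega>)) (XW W X \<omega>) (Vf f)) = c f)"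

definition Xstar :: "'v set \<Rightarrow> 'v set \<Rightarrow> ('v \<Rightarrow> 'o \<Rightarrow> 'a) \<Rightarrow>
   (('v \<Rightarrow> 'a) \<Rightarrow> ('v \<Rightarrow> 'a)) \<Rightarrow> 'o \<Rightarrow> ('v \<Rightarrow> 'a)" where
  "Xstar V W X g \<omega> = combine W (g (XW W X \<omega>)) (XW W X \<omega>) V"

definition VS :: "('f \<Rightarrow> 'v set) \<Rightarrow> 'f set \<Rightarrow> 'v set" where
  "VS Vf SF = (\<Union>f\<in>SF. Vf f)"

definition uniquely_solvable ::
  "'o measure \<Rightarrow> ('v \<Rightarrow> 'a measure) \<Rightarrow> 'v set \<Rightarrow> ('v \<Rightarrow> 'o \<Rightarrow> 'a) \<Rightarrow>
   ('f \<Rightarrow> 'v set) \<Rightarrow> ('f \<Rightarrow> ('v \<Rightarrow> 'a) \<Rightarrow> 'b) \<Rightarrow> ('f \<Rightarrow> 'b) \<Rightarrow>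
   'f set \<Rightarrow> 'v set \<Rightarrow> bool" where
  "uniquely_solvable P Xsp W X Vf phi c SF SV \<longleftrightarrow>
     (\<exists>gS \<in> PiM (VS Vf SF - SV) Xsp \<rightarrow>\<^sub>M PiM SV Xsp.
        AE xw in distr P (PiM W Xsp) (XW W X).
          \<forall>x \<in> space (PiM (VS Vf SF - W) Xsp).
             (\<forall>f\<in>SF. phi f (combine W x xw (Vf f)) = c f)
             \<longleftrightarrow> restrict x SV =
                 gS (combine W (restrict x (VS Vf SF - (SV \<union> W))) xw (VS Vf SF - SV)))"

definition perfect_matching_induced ::
  "'v set \<Rightarrow> 'v set \<Rightarrow> 'f set \<Rightarrow> ('f \<Rightarrow> 'v set) \<Rightarrow> ('v \<times> 'f) set \<Rightarrow> bool" where
  "perfect_matching_induced V W F Vf M \<longleftrightarrow>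
     M \<subseteq> {(v, f). f \<in> F \<and> v \<in> Vf f \<and> v \<notin> W} \<and>
     (\<forall>v\<in>V - W. \<exists>!f. (v, f) \<in> M) \<and>
     (\<forall>f\<in>F. \<exists>!v. (v, f) \<in> M)"

definition matched :: "('v \<times> 'f) set \<Rightarrow> ('v + 'f) set \<Rightarrow> ('v + 'f) set" where
  "matched M S = {Inr f | f. \<exists>v. (v, f) \<in> M \<and> Inl v \<in> S}
                \<union> {Inl v | v. \<exists>f. (v, f) \<in> M \<and> Inr f \<in> S}"

definition Gnodes :: "'v set \<Rightarrow> 'f set \<Rightarrow> ('v + 'f) set" where
  "Gnodes V F = Inl ` V \<union> Inr ` F"

definition GBM :: "'f set \<Rightarrow> ('f \<Rightarrow> 'v set) \<Rightarrow> ('v \<times> 'f) set \<Rightarrow> (('v + 'f) \<times> ('v + 'f)) set" where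
  "GBM F Vf M = {(Inr f, Inl v) | v f. f \<in> F \<and> v \<in> Vf f \<and> (v, f) \<in> M}
              \<union> {(Inl v, Inr f) | v f. f \<in> F \<and> v \<in> Vf f \<and> (v, f) \<notin> M}"

definition scc_of :: "'n set \<Rightarrow> ('n \<times> 'n) set \<Rightarrow> 'n \<Rightarrow> 'n set" where
  "scc_of N D x = {y \<in> N. (x, y) \<in> D\<^sup>* \<and> (y, x) \<in> D\<^sup>*}"

definition is_scc :: "'n set \<Rightarrow> ('n \<times> 'n) set \<Rightarrow> 'n set \<Rightarrow> bool" where
  "is_scc N D S \<longleftrightarrow> (\<exists>x\<in>N. S = scc_of N D x)"

text \<open>Directed paths \<open>x \<rightarrow> u1 \<rightarrow> ... \<rightarrow> uk \<rightarrow> y\<close> (\<open>k \<ge> 0\<close>) all of whose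
intermediate vertices lie in \<open>U\<close>.\<close>
definition path_through :: "('n \<times> 'n) set \<Rightarrow> 'n set \<Rightarrow> ('n \<times> 'n) set" where
  "path_through D U = (D O Id_on U)\<^sup>* O D"

definition mar_dir :: "'n set \<Rightarrow> ('n \<times> 'n) set \<Rightarrow> 'n set \<Rightarrow> ('n \<times> 'n) set" where
  "mar_dir N D U = {(x, y). x \<in> N - U \<and> y \<in> N - U \<and> (x, y) \<in> path_through D U}"

definition mar_bi :: "'n set \<Rightarrow> ('n \<times> 'n) set \<Rightarrow> 'n set \<Rightarrow> ('n \<times> 'n) set" where
  "mar_bi N D U = {(x, y). x \<in> N - U \<and> y \<in> N - U \<and>
      (\<exists>u\<in>U. (u, x) \<in> path_through D U \<and> (u, y) \<in> path_through D U)}"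

text \<open>A directed mixed graph: node set \<open>N\<close>, directed edges \<open>D\<close>, bidirected
edges \<open>Bi\<close> (symmetric).  Edge types along a path, oriented from \<open>v_i\<close> to
\<open>v_{i+1}\<close>.\<close>
datatype etype = Fwd | Bwd | Bid

fun edge_ok :: "('n \<times> 'n) set \<Rightarrow> ('n \<times> 'n) set \<Rightarrow> 'n \<Rightarrow> etype \<Rightarrow> 'n \<Rightarrow> bool" where
  "edge_ok D Bi a Fwd b \<longleftrightarrow> (a, b) \<in> D"
| "edge_ok D Bi a Bwd b \<longleftrightarrow> (b, a) \<in> D"
| "edge_ok D Bi a Bid b \<longleftrightarrow> (a, b) \<in> Bi \<or> (b, a) \<in> Bi"

definition is_mpath :: "'n set \<Rightarrow> ('n \<times> 'n) set \<Rightarrow> ('n \<times> 'n) set \<Rightarrow> 'n list \<Rightarrow> etype list \<Rightarrow> bool" where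
  "is_mpath N D Bi vs es \<longleftrightarrow>
     vs \<noteq> [] \<and> distinct vs \<and> set vs \<subseteq> N \<and> length es = length vs - 1 \<and>
     (\<forall>i < length es. edge_ok D Bi (vs ! i) (es ! i) (vs ! Suc i))"

definition ancestors :: "'n set \<Rightarrow> ('n \<times> 'n) set \<Rightarrow> 'n set \<Rightarrow> 'n set" where
  "ancestors N D Z = {x \<in> N. \<exists>z\<in>Z. (x, z) \<in> D\<^sup>*}"

definition sigma_blocked ::
  "'n set \<Rightarrow> ('n \<times> 'n) set \<Rightarrow> 'n set \<Rightarrow> 'n list \<Rightarrow> etype list \<Rightarrow> bool" where
  "sigma_blocked N D Z vs es \<longleftrightarrow>
     hd vs \<in> Z \<or> last vs \<in> Z \<or>
     (\<exists>i. 0 < i \<and> i < length es \<and> es ! (i - 1) \<in> {Fwd, Bid} \<and> es ! i \<in> {Bwd, Bid}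
          \<and> vs ! i \<notin> ancestors N D Z) \<or>
     (\<exists>i < length es. vs ! i \<in> Z \<and> es ! i = Fwd \<and> vs ! Suc i \<notin> scc_of N D (vs ! i)) \<or>
     (\<exists>i. 0 < i \<and> i < length vs \<and> vs ! i \<in> Z \<and> es ! (i - 1) = Bwd
          \<and> vs ! (i - 1) \<notin> scc_of N D (vs ! i))"

definition sigma_separated ::
  "'n set \<Rightarrow> ('n \<times> 'n) set \<Rightarrow> ('n \<times> 'n) set \<Rightarrow> 'n set \<Rightarrow> 'n set \<Rightarrow> 'n set \<Rightarrow> bool" where
  "sigma_separated N D Bi A B C \<longleftrightarrow>
     (\<forall>vs es. is_mpath N D Bi vs es \<and>
        ((hd vs \<in> A \<and> last vs \<in> B) \<or> (hd vs \<in> B \<and> last vs \<in> A))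
        \<longrightarrow> sigma_blocked N D C vs es)"

definition gdgmp ::
  "'v set \<Rightarrow> (('v + 'f) \<times> ('v + 'f)) set \<Rightarrow> (('v + 'f) \<times> ('v + 'f)) set \<Rightarrow>
   ('v \<Rightarrow> 'a measure) \<Rightarrow> ('v \<Rightarrow> 'a) measure \<Rightarrow> bool" where
  "gdgmp V D Bi Xsp Q \<longleftrightarrow>
     (\<forall>A B C. A \<subseteq> V \<and> B \<subseteq> V \<and> C \<subseteq> V \<and>
        sigma_separated (Inl ` V) D Bi (Inl ` A) (Inl ` B) (Inl ` C)
        \<longrightarrow> cond_indep Q (PiM A Xsp) (PiM B Xsp) (PiM C Xsp)
               (\<lambda>x. restrict x A) (\<lambda>x. restrict x B) (\<lambda>x. restrict x C))"

end

theory Submission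
  imports Defs
begin

text \<open>The matched constraint graph, marginalized to the variables, has no proper bidirected edges, and its
  strongly connected components outside \<^term>\<open>W\<close> are exactly the clusters of the unique solvability
  assumption. So the variables of such a component are almost surely a function of the variables of
  its outside parents, while the components in \<^term>\<open>W\<close> are independent.

  Separation of \<^term>\<open>A\<close> and \<^term>\<open>B\<close> by \<^term>\<open>C\<close> yields a cover \<^term>\<open>G \<union> H\<close> of the ancestral set
  with \<^term>\<open>G \<inter> H = C\<close>, \<^term>\<open>A \<subseteq> G\<close>, \<^term>\<open>B \<subseteq> H\<close>, in which every component together with its parents
  lies on one side: \<^term>\<open>G\<close> consists of \<^term>\<open>C\<close> and of what open walks from \<^term>\<open>A\<close> reach.
  The two sides of such a cover are conditionally independent given their intersection. This goes by
  induction on the variables outside \<^term>\<open>W\<close>: drop a terminal component contained, with its parents, in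
  \<^term>\<open>G\<close>; by determinism it adds no information to \<^term>\<open>G\<close>, and conditioning in addition
  on its part in \<^term>\<open>H\<close> is harmless because that part is a function of \<^term>\<open>G\<close>.\<close>

section \<open>Open walks and separation\<close>

text \<open>The Boolean argument records whether the last edge has its arrowhead at the end node, which then
  becomes a collider when the walk continues against the next arrow.\<close>
inductive open_walk :: "'n set \<Rightarrow> ('n \<times> 'n) set \<Rightarrow> 'n set \<Rightarrow> 'n set \<Rightarrow> 'n \<Rightarrow> bool \<Rightarrow> bool"
  for N D C A where
  start: "a \<in> A \<Longrightarrow> a \<in> N \<Longrightarrow> a \<notin> C \<Longrightarrow> open_walk N D C A a False"
| fwd: "open_walk N D C A v h \<Longrightarrow> (v, w) \<in> D \<Longrightarrow> w \<in> N \<Longrightarrow> (v \<in> C \<longrightarrow> w \<in> scc_of N D v) \<Longrightarrow>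
    open_walk N D C A w True"
| bwd: "open_walk N D C A v h \<Longrightarrow> (w, v) \<in> D \<Longrightarrow> w \<in> N \<Longrightarrow> (w \<in> C \<longrightarrow> v \<in> scc_of N D w) \<Longrightarrow>
    (h \<longrightarrow> v \<in> ancestors N D C) \<Longrightarrow> open_walk N D C A w False"

section \<open>Walks as lists, and their reduction to unblocked paths\<close>

definition mixed_walk :: "'n set \<Rightarrow> ('n \<times> 'n) set \<Rightarrow> ('n \<times> 'n) set \<Rightarrow> 'n list \<Rightarrow> etype list \<Rightarrow> bool" where
  "mixed_walk N D Bi vs es \<longleftrightarrow> vs \<noteq> [] \<and> set vs \<subseteq> N \<and> length es = length vs - 1 \<and>
     (\<forall>i < length es. edge_ok D Bi (vs ! i) (es ! i) (vs ! Suc i)) \<and> Bid \<notin> set es"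

text \<open>Negates the collider and non-collider clauses of \<open>sigma_blocked\<close> for walks
  without \<open>Bid\<close>. The clause on end nodes is kept apart, since the last node changes
  while a walk is being extended and may lie in \<open>C\<close> on the way.\<close>

definition unblocked_inside :: "'n set \<Rightarrow> ('n \<times> 'n) set \<Rightarrow> 'n set \<Rightarrow> 'n list \<Rightarrow> etype list \<Rightarrow> bool" where
  "unblocked_inside N D C vs es \<longleftrightarrow>
     (\<forall>i. Suc i < length es \<longrightarrow> es ! i = Fwd \<longrightarrow> es ! Suc i = Bwd \<longrightarrow> vs ! Suc i \<in> ancestors N D C) \<and>
     (\<forall>i < length es. es ! i = Fwd \<longrightarrow> vs ! i \<in> C \<longrightarrow> vs ! Suc i \<in> scc_of N D (vs ! i)) \<and>
     (\<forall>i < length es. es ! i = Bwd \<longrightarrow> vs ! Suc i \<in> C \<longrightarrow> vs ! i \<in> scc_of N D (vs ! Suc i))"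

lemma not_sigma_blockedI:
  assumes "mixed_walk N D Bi vs es" "unblocked_inside N D C vs es" "hd vs \<notin> C" "last vs \<notin> C"
  shows "\<not> sigma_blocked N D C vs es"
proof
  assume "sigma_blocked N D C vs es"
  with assms(3,4) consider
    i where "0 < i" "i < length es" "es ! (i - 1) \<in> {Fwd, Bid}" "es ! i \<in> {Bwd, Bid}"
      "vs ! i \<notin> ancestors N D C"
  | i where "i < length es" "vs ! i \<in> C" "es ! i = Fwd" "vs ! Suc i \<notin> scc_of N D (vs ! i)"
  | i where "0 < i" "i < length vs" "vs ! i \<in> C" "es ! (i - 1) = Bwd"
      "vs ! (i - 1) \<notin> scc_of N D (vs ! i)"
    unfolding sigma_blocked_def by blast
  then show False
  proof cases
    case 1
    then obtain k where k: "i = Suc k" by (cases i) auto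
    have "es ! k \<in> set es" "es ! i \<in> set es" using 1(2) k by auto
    then have "es ! k \<noteq> Bid" "es ! i \<noteq> Bid"
      using assms(1) unfolding mixed_walk_def by auto
    then show False using 1 k assms(2) unfolding unblocked_inside_def by auto
  next
    case 2
    with assms(2) show False unfolding unblocked_inside_def by blast
  next
    case 3
    then obtain k where k: "i = Suc k" by (cases i) auto
    have "k < length es" using 3(2) k assms(1) unfolding mixed_walk_def by auto
    then show False using 3 k assms(2) unfolding unblocked_inside_def by auto
  qed
qed

text \<open>The flag \<open>h\<close> is carried through the induction because, in the case
  \<open>bwd\<close>, it decides whether the appended backward edge turns the old end node into a
  collider.\<close>

lemma open_walk_imp_list:
  assumes "open_walk N D C A v h"
  shows "\<exists>vs es. mixed_walk N D Bi vs es \<and> unblocked_inside N D C vs es \<and> hd vs \<in> A \<and> hd vs \<notin> C \<and>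
    last vs = v \<and> (h \<longleftrightarrow> es \<noteq> [] \<and> last es = Fwd)"
  using assms
proof induction
  case (start a)
  then show ?case
    by (intro exI[of _ "[a]"] exI[of _ "[]"]) (auto simp: mixed_walk_def unblocked_inside_def)
next
  case (fwd v h w)
  then obtain vs es where *: "mixed_walk N D Bi vs es" "unblocked_inside N D C vs es" "hd vs \<in> A" "hd vs \<notin> C"
    "last vs = v" by blast
  then have len: "length vs = Suc (length es)" "vs \<noteq> []" "vs ! length es = v"
    unfolding mixed_walk_def by (auto simp: last_conv_nth)
  have "mixed_walk N D Bi (vs @ [w]) (es @ [Fwd])"
    using *(1) fwd(2,3) len unfolding mixed_walk_def by (auto simp: nth_append less_Suc_eq)
  moreover have "unblocked_inside N D C (vs @ [w]) (es @ [Fwd])"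
    using *(2) fwd(4) len unfolding unblocked_inside_def by (auto simp: nth_append less_Suc_eq)
  ultimately show ?case
    using * len by (intro exI[of _ "vs @ [w]"] exI[of _ "es @ [Fwd]"]) auto
next
  case (bwd v h w)
  then obtain vs es where *: "mixed_walk N D Bi vs es" "unblocked_inside N D C vs es" "hd vs \<in> A" "hd vs \<notin> C"
    "last vs = v" "h \<longleftrightarrow> es \<noteq> [] \<and> last es = Fwd" by blast
  then have len: "length vs = Suc (length es)" "vs \<noteq> []" "vs ! length es = v"
    unfolding mixed_walk_def by (auto simp: last_conv_nth)
  have "mixed_walk N D Bi (vs @ [w]) (es @ [Bwd])"
    using *(1) bwd(2,3) len unfolding mixed_walk_def by (auto simp: nth_append less_Suc_eq)
  moreover have "vs ! Suc i \<in> ancestors N D C" if "Suc i = length es" "es ! i = Fwd" for i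
  proof -
    have "es \<noteq> []" "last es = Fwd"
      using that last_conv_nth[of es] by (metis list.size(3) nat.distinct(1), metis diff_Suc_1 list.size(3) nat.distinct(1))
    then show ?thesis using that(1) len(3) bwd(5) *(6) by auto
  qed
  then have "unblocked_inside N D C (vs @ [w]) (es @ [Bwd])"
    using *(2) bwd(4) len unfolding unblocked_inside_def by (auto simp: nth_append less_Suc_eq)
  ultimately show ?case
    using * len by (intro exI[of _ "vs @ [w]"] exI[of _ "es @ [Bwd]"]) auto
qed

text \<open>The run of forward edges starting at \<open>i\<close> has to stop because of the
  backward edge at \<open>j\<close>. As no edge is bidirected, it stops at a collider, which
  directed edges reach from \<open>vs ! i\<close>.\<close>

lemma fwd_run_collider:
  assumes w: "mixed_walk N D Bi vs es"
    and ij: "i < j" "j < length es" and e: "es ! i = Fwd" "es ! j = Bwd"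
  shows "\<exists>m. m < j \<and> es ! m = Fwd \<and> es ! Suc m = Bwd \<and> (vs ! i, vs ! Suc m) \<in> D\<^sup>*"
proof -
  let ?P = "\<lambda>m. i \<le> m \<and> es ! Suc m \<noteq> Fwd"
  define m where "m = Least ?P"
  have ex: "?P (j - 1)" using ij e by auto
  have m: "i \<le> m" "es ! Suc m \<noteq> Fwd" "m \<le> j - 1"
    unfolding m_def using LeastI[of ?P, OF ex] Least_le[of ?P, OF ex] by auto
  have run: "es ! k = Fwd" if "i \<le> k" "k \<le> m" for k
  proof (cases "k = i")
    case False
    then have "k - 1 < m" "i \<le> k - 1" "Suc (k - 1) = k" using that by auto
    with not_less_Least[of "k - 1" ?P] show ?thesis unfolding m_def by auto
  qed (use e in simp)
  have edge: "(vs ! k, vs ! Suc k) \<in> D" if "i \<le> k" "k \<le> m" for k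
  proof -
    have "edge_ok D Bi (vs ! k) (es ! k) (vs ! Suc k)"
      using w that m(3) ij unfolding mixed_walk_def by auto
    then show ?thesis using run[OF that] by simp
  qed
  have "(vs ! i, vs ! Suc k) \<in> D\<^sup>*" if "i \<le> k" "k \<le> m" for k
    using that
  proof (induction k rule: dec_induct)
    case base
    then show ?case using edge[of i] by auto
  next
    case (step k)
    then show ?case using edge[of "Suc k"] by (auto intro: rtrancl.rtrancl_into_rtrancl)
  qed
  moreover have "es ! Suc m \<in> set es" using m ij by (intro nth_mem) auto
  then have "es ! Suc m \<noteq> Bid" using w unfolding mixed_walk_def by metis
  then have "es ! Suc m = Bwd" using m(2) by (cases "es ! Suc m") auto
  ultimately show ?thesis using m run ij by (intro exI[of _ m]) auto
qed

text \<open>Cutting out the loop between two visits of a node keeps a walk open: the only new obstruction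
  would be a collider outside the ancestors of \<^term>\<open>C\<close>, but then the loop leaves and enters the node
  through tails, hence contains an open collider that descends from the node.\<close>
lemma shortcut:
  assumes w: "mixed_walk N D Bi vs es" and o: "unblocked_inside N D C vs es"
    and ij: "i < j" "j < length vs" "vs ! i = vs ! j"
  defines "vs' \<equiv> take i vs @ drop j vs" and "es' \<equiv> take i es @ drop j es"
  shows "mixed_walk N D Bi vs' es' \<and> unblocked_inside N D C vs' es' \<and> hd vs' = hd vs \<and> last vs' = last vs \<and>
    length vs' < length vs"
proof -
  have len: "length vs = Suc (length es)" using w ij unfolding mixed_walk_def by auto
  define s where "s = j - i"
  have j: "j = i + s" "0 < s" using ij unfolding s_def by auto
  have len': "length vs' = length vs - s" "length es' = length es - s" "length vs' = Suc (length es')"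
    using ij len unfolding vs'_def es'_def s_def by auto
  have es1: "es' ! k = es ! k" if "k < i" for k
    using that ij len unfolding es'_def by (auto simp: nth_append)
  have es2: "es' ! k = es ! (k + s)" if "i \<le> k" for k
    using that ij len unfolding es'_def j(1) by (auto simp: nth_append algebra_simps)
  have vs2: "vs' ! k = vs ! (k + s)" if "i \<le> k" for k
    using that ij unfolding vs'_def j(1) by (auto simp: nth_append algebra_simps)
  \<comment> \<open>The descriptions of both pieces overlap at \<open>k = i\<close>, where the two
    visits carry the same node.\<close>
  have vs1: "vs' ! k = vs ! k" if "k \<le> i" for k
  proof (cases "k = i")
    case True
    then show ?thesis using vs2[of i] ij j by simp
  next
    case False
    then show ?thesis using that ij unfolding vs'_def by (auto simp: nth_append)
  qed
  have edge: "edge_ok D Bi (vs' ! k) (es' ! k) (vs' ! Suc k)" if "k < length es'" for k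
  proof (cases "k < i")
    case True
    then show ?thesis using w that len' ij len es1 vs1 unfolding mixed_walk_def by auto
  next
    case False
    then have "edge_ok D Bi (vs ! (k + s)) (es ! (k + s)) (vs ! Suc (k + s))"
      using w that len' unfolding mixed_walk_def by auto
    then show ?thesis using False es2[of k] vs2[of k] vs2[of "Suc k"] by auto
  qed
  have "mixed_walk N D Bi vs' es'"
    unfolding mixed_walk_def
  proof (intro conjI)
    show "set vs' \<subseteq> N" using w unfolding mixed_walk_def vs'_def
      by (auto dest: in_set_takeD in_set_dropD)
    show "Bid \<notin> set es'" using w unfolding mixed_walk_def es'_def
      by (auto dest: in_set_takeD in_set_dropD)
  qed (use len' edge in auto)
  moreover have "hd vs' = hd vs"
  proof -
    have "vs' \<noteq> []" "vs \<noteq> []" using len' len by auto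
    then show ?thesis using vs1[of 0] by (simp add: hd_conv_nth)
  qed
  moreover have "last vs' = last vs" using ij unfolding vs'_def by simp
  moreover have "length vs' < length vs" using len' len j ij by simp
  moreover have "unblocked_inside N D C vs' es'"
    unfolding unblocked_inside_def
  proof (intro conjI allI impI)
    fix k assume k: "k < length es'" "es' ! k = Fwd" "vs' ! k \<in> C"
    show "vs' ! Suc k \<in> scc_of N D (vs' ! k)"
    proof (cases "k < i")
      case True
      then show ?thesis using o k len' es1[of k] vs1[of k] vs1[of "Suc k"] unfolding unblocked_inside_def by auto
    next
      case False
      then show ?thesis using o k len' es2[of k] vs2[of k] vs2[of "Suc k"] unfolding unblocked_inside_def by auto
    qed
  next
    fix k assume k: "k < length es'" "es' ! k = Bwd" "vs' ! Suc k \<in> C"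
    show "vs' ! k \<in> scc_of N D (vs' ! Suc k)"
    proof (cases "k < i")
      case True
      then show ?thesis using o k len' es1[of k] vs1[of k] vs1[of "Suc k"] unfolding unblocked_inside_def by auto
    next
      case False
      then show ?thesis using o k len' es2[of k] vs2[of k] vs2[of "Suc k"] unfolding unblocked_inside_def by auto
    qed
  next
    fix k assume k: "Suc k < length es'" "es' ! k = Fwd" "es' ! Suc k = Bwd"
    consider "Suc k < i" | "Suc k = i" | "i \<le> k" by linarith
    then show "vs' ! Suc k \<in> ancestors N D C"
    proof cases
      case 1
      then show ?thesis using o k len' es1[of k] es1[of "Suc k"] vs1[of "Suc k"]
        unfolding unblocked_inside_def by auto
    next
      case 3
      then show ?thesis using o k len' es2[of k] es2[of "Suc k"] vs2[of "Suc k"]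
        unfolding unblocked_inside_def by auto
    next
      \<comment> \<open>The junction of the two pieces. A backward edge at \<open>i\<close> makes
        the node a collider of the original walk already; otherwise the loop starts with a forward
        run.\<close>
      case 2
      have v: "vs' ! Suc k = vs ! i" using vs1[of "Suc k"] 2 by simp
      have ek: "es ! k = Fwd" "es ! j = Bwd" using k 2 es1[of k] es2[of i] j by auto
      have jl: "j < length es" using k(1) 2 len' j by simp
      have nB: "es ! i \<noteq> Bid"
        using w jl ij nth_mem[of i es] unfolding mixed_walk_def by (auto simp del: nth_mem)
      show ?thesis
      proof (cases "es ! i = Bwd")
        case True
        have "Suc k < length es" using 2 jl ij by simp
        then have "vs ! Suc k \<in> ancestors N D C"
          using o ek(1) True 2 unfolding unblocked_inside_def by blast
        then show ?thesis using v 2 by simp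
      next
        case False
        then have "es ! i = Fwd" using nB by (cases "es ! i") auto
        \<comment> \<open>The edge at \<open>j\<close> is the one that follows the loop, so the
          collider found may be the second visit itself.\<close>
        from fwd_run_collider[OF w ij(1) jl this ek(2)] obtain m where
          m: "m < j" "es ! m = Fwd" "es ! Suc m = Bwd" "(vs ! i, vs ! Suc m) \<in> D\<^sup>*"
          by blast
        have "vs ! Suc m \<in> ancestors N D C"
          using o m jl unfolding unblocked_inside_def by auto
        moreover have "vs ! i \<in> N" using w ij nth_mem[of i vs] unfolding mixed_walk_def by (auto simp del: nth_mem)
        ultimately show ?thesis using m(4) v unfolding ancestors_def
          by (auto intro: rtrancl_trans)
      qed
    qed
  qed
  ultimately show ?thesis by blast
qed

lemma mixed_walk_shorten:
  assumes "mixed_walk N D Bi vs es" "unblocked_inside N D C vs es"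
  shows "\<exists>vs' es'. mixed_walk N D Bi vs' es' \<and> unblocked_inside N D C vs' es' \<and> distinct vs' \<and>
    hd vs' = hd vs \<and> last vs' = last vs"
  using assms
proof (induction "length vs" arbitrary: vs es rule: less_induct)
  case less
  show ?case
  proof (cases "distinct vs")
    case False
    then obtain i j where "i < j" "j < length vs" "vs ! i = vs ! j"
      unfolding distinct_conv_nth by (metis nat_neq_iff)
    from shortcut[OF less.prems this] less.hyps show ?thesis by metis
  qed (use less.prems in blast)
qed

text \<open>Shortening preserves both end nodes, and these lie outside \<open>C\<close>; so an open
  walk yields a path with distinct nodes that is not blocked.\<close>

lemma open_walk_not_sigma_separated:
  assumes "open_walk N D C A b h" "b \<in> B" "b \<notin> C"
  shows "\<not> sigma_separated N D Bi A B C"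
proof -
  obtain vs es where "mixed_walk N D Bi vs es" "unblocked_inside N D C vs es" "hd vs \<in> A" "hd vs \<notin> C" "last vs = b"
    using open_walk_imp_list[OF assms(1)] by blast
  with mixed_walk_shorten obtain vs es where
    *: "mixed_walk N D Bi vs es" "unblocked_inside N D C vs es" "distinct vs" "hd vs \<in> A" "hd vs \<notin> C" "last vs = b"
    by metis
  then have "is_mpath N D Bi vs es" "\<not> sigma_blocked N D C vs es"
    using not_sigma_blockedI[of N D Bi vs es C] assms(3) unfolding mixed_walk_def is_mpath_def by auto
  with * assms(2) show ?thesis unfolding sigma_separated_def by blast
qed

section \<open>Components together with their parents, and the cover obtained from a
  separation\<close>

definition scc_family :: "'n set \<Rightarrow> ('n \<times> 'n) set \<Rightarrow> 'n \<Rightarrow> 'n set" where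
  "scc_family N D k = scc_of N D k \<union> {x. \<exists>y\<in>scc_of N D k. (x, y) \<in> D}"

text \<open>Forward steps create no collider, and inside a component they are allowed even from
  nodes of \<open>C\<close>.\<close>

lemma open_walk_scc:
  assumes "open_walk N D C A v h" "w \<in> scc_of N D v" "D \<subseteq> N \<times> N"
  shows "\<exists>h. open_walk N D C A w h"
proof -
  have "(v, w) \<in> D\<^sup>*" "(w, v) \<in> D\<^sup>*" using assms(2) unfolding scc_of_def by auto
  then show ?thesis
  proof (induction rule: rtrancl_induct)
    case (step y z)
    have "(y, v) \<in> D\<^sup>*" using step(2,4) by (rule converse_rtrancl_into_rtrancl)
    then obtain h where "open_walk N D C A y h" using step(3) by blast
    moreover have "z \<in> scc_of N D y"
      using step assms(3) unfolding scc_of_def by (auto intro: rtrancl_trans)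
    ultimately show ?case using step(2) assms(3) by (blast intro: open_walk.fwd)
  qed (use assms(1) in blast)
qed

text \<open>No descendant of \<open>v\<close> lies in \<open>C\<close>, so nothing obstructs a
  forward step.\<close>

lemma open_walk_descend:
  assumes "open_walk N D C A v h" "v \<notin> ancestors N D C" "(v, w) \<in> D\<^sup>*" "D \<subseteq> N \<times> N" "v \<in> N"
  shows "\<exists>h. open_walk N D C A w h"
  using assms(3)
proof (induction rule: rtrancl_induct)
  case (step y z)
  then obtain h where "open_walk N D C A y h" by blast
  moreover have "y \<notin> C" using assms(2,5) step(1) unfolding ancestors_def by auto
  ultimately show ?case using step(2) assms(4) by (blast intro: open_walk.fwd)
qed (use assms(1) in blast)

text \<open>The walk starts at \<open>a\<close> and runs against the arrows. It meets only tails at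
  its current end, hence no collider, and its nodes avoid \<open>C\<close> because they descend from
  \<open>v\<close>.\<close>

lemma open_walk_ascend:
  assumes "(v, a) \<in> D\<^sup>*" "a \<in> A" "v \<notin> ancestors N D C" "v \<in> N" "D \<subseteq> N \<times> N"
  shows "open_walk N D C A v False"
  using assms(1,3,4)
proof (induction rule: converse_rtrancl_induct)
  case base
  then have "a \<notin> C" unfolding ancestors_def by auto
  then show ?case using base assms(2) by (auto intro: open_walk.start)
next
  case (step y z)
  have "z \<in> N" using step(1) assms(5) by auto
  moreover have "z \<notin> ancestors N D C"
    using step(1,4,5) unfolding ancestors_def by (auto intro: converse_rtrancl_into_rtrancl)
  moreover have "y \<notin> C" using step(4,5) unfolding ancestors_def by auto
  ultimately show ?case using step by (blast intro: open_walk.bwd)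
qed

text \<open>A node reached by an open walk inside a family passes on to the rest of the family: through
  the component if it has descendants in \<^term>\<open>C\<close>; otherwise the component has a descendant in
  \<^term>\<open>A\<close>, from which one walks up, or in \<^term>\<open>B\<close>, which contradicts separation.\<close>
lemma open_walk_family:
  assumes D: "D \<subseteq> N \<times> N" and sep: "sigma_separated N D Bi A B C"
    and k: "k \<in> ancestors N D (A \<union> B \<union> C)"
    and x: "x \<in> scc_family N D k" "x \<notin> C" "open_walk N D C A x h"
    and y: "y \<in> scc_family N D k" "y \<notin> C"
  shows "\<exists>h. open_walk N D C A y h"
proof -
  let ?K = "scc_of N D k"
  have kN: "k \<in> N" using k unfolding ancestors_def by auto
  have scc: "z' \<in> scc_of N D z" if "z \<in> ?K" "z' \<in> ?K" for z z'
    using that unfolding scc_of_def by (auto intro: rtrancl_trans)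
  have kK: "k \<in> ?K" using kN unfolding scc_of_def by auto
  \<comment> \<open>If \<open>x\<close> is only a parent of the component, a forward step enters it;
    this is allowed since \<open>x\<close> is not in \<open>C\<close>.\<close>
  obtain z hz where z: "z \<in> ?K" "open_walk N D C A z hz"
  proof (cases "x \<in> ?K")
    case False
    then obtain z where "z \<in> ?K" "(x, z) \<in> D" using x(1) unfolding scc_family_def by auto
    then show thesis using that open_walk.fwd[OF x(3) \<open>(x, z) \<in> D\<close>] x(2) D by blast
  qed (use that x in blast)
  have oK: "\<exists>h. open_walk N D C A z' h" if "z' \<in> ?K" for z'
    using open_walk_scc[OF z(2) scc[OF z(1) that] D] .
  have anc: "z \<in> ancestors N D C \<longleftrightarrow> k \<in> ancestors N D C" if "z \<in> ?K" for z
    using that kN unfolding scc_of_def ancestors_def by (auto intro: rtrancl_trans)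
  have yN: "y \<in> N" using y D unfolding scc_family_def scc_of_def by auto
  \<comment> \<open>A step up to a parent makes the component node a collider if it was entered
    through an arrowhead, hence the proviso on \<open>h\<close>.\<close>
  have top: ?thesis if o: "\<And>z'. z' \<in> ?K \<Longrightarrow> \<exists>h. open_walk N D C A z' h \<and> (h \<longrightarrow> z' \<in> ancestors N D C)"
  proof (cases "y \<in> ?K")
    case False
    then obtain z' where "z' \<in> ?K" "(y, z') \<in> D" using y(1) unfolding scc_family_def by auto
    then show ?thesis using o[of z'] y(2) yN by (blast intro: open_walk.bwd)
  qed (use o in blast)
  show ?thesis
  proof (cases "k \<in> ancestors N D C")
    case True
    then show ?thesis using top oK anc by blast
  next
    case False
    then consider a where "a \<in> A" "(k, a) \<in> D\<^sup>*" | b where "b \<in> B" "(k, b) \<in> D\<^sup>*"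
      using k unfolding ancestors_def by auto
    then show ?thesis
    proof cases
      case 1
      \<comment> \<open>Coming up from \<open>a\<close>, the walk has no arrowhead at
        \<open>z'\<close>; going on to a parent creates no collider although \<open>z'\<close> has
        no descendant in \<open>C\<close>.\<close>
      have "open_walk N D C A z' False" if "z' \<in> ?K" for z'
        using 1 that False anc[OF that] D open_walk_ascend[of z' a D A N C]
        unfolding scc_of_def by (auto intro: rtrancl_trans)
      then show ?thesis using top by blast
    next
      case 2
      obtain h where "open_walk N D C A k h" using oK kK by blast
      then obtain h where "open_walk N D C A b h" using open_walk_descend[OF _ False 2(2) D kN] by blast
      moreover have "b \<notin> C" using False 2 kN unfolding ancestors_def by auto
      ultimately show ?thesis using sep open_walk_not_sigma_separated 2(1) by metis
    qed
  qed
qed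

text \<open>A family that meets \<open>R\<close> has all its nodes outside \<open>C\<close> in
  \<open>R\<close>, by \<open>open_walk_family\<close>; a family that misses \<open>R\<close> lies
  on the other side. Separation keeps \<open>B\<close> out of \<open>R\<close>.\<close>

lemma sigma_separated_cover:
  assumes D: "D \<subseteq> N \<times> N" and ABC: "A \<subseteq> N" "B \<subseteq> N" "C \<subseteq> N"
    and sep: "sigma_separated N D Bi A B C"
  shows "\<exists>G H. G \<inter> H = C \<and> A \<subseteq> G \<and> B \<subseteq> H \<and> G \<subseteq> N \<and> H \<subseteq> N \<and>
    (\<forall>k\<in>G \<union> H. scc_family N D k \<subseteq> G \<or> scc_family N D k \<subseteq> H)"
proof -
  define U where "U = ancestors N D (A \<union> B \<union> C)"
  define R where "R = {x \<in> U - C. \<exists>h. open_walk N D C A x h}"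
  have U: "A \<subseteq> U" "B \<subseteq> U" "C \<subseteq> U" "U \<subseteq> N" using ABC unfolding U_def ancestors_def by auto
  \<comment> \<open>An ancestral set is closed under components and parents.\<close>
  have fam: "scc_family N D k \<subseteq> U" if "k \<in> U" for k
  proof
    fix x assume "x \<in> scc_family N D k"
    then have "(x, k) \<in> D\<^sup>*" "x \<in> N"
      using D unfolding scc_family_def scc_of_def by (auto intro: converse_rtrancl_into_rtrancl)
    then show "x \<in> U" using that unfolding U_def ancestors_def by (auto intro: rtrancl_trans)
  qed
  have "A - C \<subseteq> R" using ABC U unfolding R_def by (auto intro: open_walk.start)
  moreover have "b \<notin> R" if "b \<in> B" for b
    using that sep open_walk_not_sigma_separated[of N D C A b _ B Bi] unfolding R_def by blast
  moreover have "scc_family N D k \<subseteq> C \<union> R \<or> scc_family N D k \<subseteq> C \<union> (U - R)" if "k \<in> U" for k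
  proof (cases "\<exists>x\<in>scc_family N D k. x \<in> R")
    case True
    then obtain x h where x: "x \<in> scc_family N D k" "x \<notin> C" "open_walk N D C A x h"
      unfolding R_def by blast
    have "y \<in> C \<union> R" if y: "y \<in> scc_family N D k" for y
      using open_walk_family[OF D sep _ x y] \<open>k \<in> U\<close> fam[OF \<open>k \<in> U\<close>] y unfolding R_def U_def by blast
    then show ?thesis by blast
  next
    case False
    then show ?thesis using fam[OF that] by blast
  qed
  moreover have "(C \<union> R) \<inter> (C \<union> (U - R)) = C" "C \<union> R \<union> (C \<union> (U - R)) = U"
    using U unfolding R_def by auto
  ultimately show ?thesis
    using U by (intro exI[of _ "C \<union> R"] exI[of _ "C \<union> (U - R)"]) auto
qed

section \<open>Conditional independence of subalgebras\<close>

text \<open>This symmetric form is equivalent to conditional independence only if \<^term>\<open>C\<close> is contained in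
  \<^term>\<open>G\<close> or \<^term>\<open>H\<close>: it integrates over the whole space instead of over the sets of \<^term>\<open>C\<close>.\<close>
definition indep_given :: "'o measure \<Rightarrow> 'o measure \<Rightarrow> 'o measure \<Rightarrow> 'o measure \<Rightarrow> bool" where
  "indep_given M C G H \<longleftrightarrow> (\<forall>a\<in>sets G. \<forall>b\<in>sets H. measure M (a \<inter> b) =
     (\<integral>x. real_cond_exp M C (indicator a) x * real_cond_exp M C (indicator b) x \<partial>M))"

lemma indep_given_sym: "indep_given M C G H \<Longrightarrow> indep_given M C H G"
  unfolding indep_given_def
proof (intro ballI)
  fix a b assume *: "\<forall>a\<in>sets G. \<forall>b\<in>sets H. measure M (a \<inter> b) =
     (\<integral>x. real_cond_exp M C (indicator a) x * real_cond_exp M C (indicator b) x \<partial>M)"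
    and "a \<in> sets H" "b \<in> sets G"
  then have "measure M (b \<inter> a) =
     (\<integral>x. real_cond_exp M C (indicator b) x * real_cond_exp M C (indicator a) x \<partial>M)"
    by blast
  then show "measure M (a \<inter> b) =
     (\<integral>x. real_cond_exp M C (indicator a) x * real_cond_exp M C (indicator b) x \<partial>M)"
    by (simp only: Int_commute mult.commute)
qed

section \<open>Rules for conditional independence over nested subalgebras\<close>

context prob_space
begin

lemma finite_measure_subalgebraI: "subalgebra M C \<Longrightarrow> finite_measure_subalgebra M C"
  by (simp add: finite_measure_axioms finite_measure_subalgebra.intro finite_measure_subalgebra_axioms.intro)

lemma subalgebra_sets: "subalgebra M C \<Longrightarrow> a \<in> sets C \<Longrightarrow> a \<in> events"
  by (auto simp: subalgebra_def)

lemma integrable_ind: "a \<in> events \<Longrightarrow> integrable M (indicator a :: _ \<Rightarrow> real)"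
  by (simp add: emeasure_eq_measure)

lemma integrable_ind_mult:
  fixes f :: "'a \<Rightarrow> real"
  assumes "integrable M f" "a \<in> events"
  shows "integrable M (\<lambda>x. indicator a x * f x)"
  using integrable_real_mult_indicator[OF assms(2,1)] by (simp add: mult.commute)

lemma cond_exp_selfadjoint:
  assumes C: "subalgebra M C" and f: "f \<in> borel_measurable C" "integrable M f" and a: "a \<in> events"
  shows "integrable M (\<lambda>x. f x * real_cond_exp M C (indicator a) x)"
    and "(\<integral>x. f x * indicator a x \<partial>M) = (\<integral>x. f x * real_cond_exp M C (indicator a) x \<partial>M)"
proof -
  interpret finite_measure_subalgebra M C using finite_measure_subalgebraI[OF C] .
  have "integrable M (\<lambda>x. f x * indicator a x)"
    using integrable_real_mult_indicator[OF a f(2)] by (simp add: mult.commute)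
  from real_cond_exp_intg[OF this f(1)] a show
    "integrable M (\<lambda>x. f x * real_cond_exp M C (indicator a) x)"
    "(\<integral>x. f x * indicator a x \<partial>M) = (\<integral>x. f x * real_cond_exp M C (indicator a) x \<partial>M)"
    by auto
qed

lemma integrable_cond_exp_ind:
  assumes "subalgebra M C" "a \<in> events"
  shows "integrable M (real_cond_exp M C (indicator a))"
proof -
  interpret finite_measure_subalgebra M C using finite_measure_subalgebraI[OF assms(1)] .
  show ?thesis using real_cond_exp_int(1) integrable_ind[OF assms(2)] .
qed

lemma indep_given_integral_eq:
  assumes C: "subalgebra M C" and ab: "a \<in> events" "b \<in> events"
  shows "(\<integral>x. real_cond_exp M C (indicator a) x * real_cond_exp M C (indicator b) x \<partial>M)
    = (\<integral>x. indicator a x * real_cond_exp M C (indicator b) x \<partial>M)"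
  using cond_exp_selfadjoint(2)[OF C _ integrable_cond_exp_ind[OF C ab(2)] ab(1)]
  by (simp add: mult.commute)

text \<open>Conditional expectation is self-adjoint, so one of the two may be dropped. What remains
  prescribes the integrals of the conditional probability of \<open>b\<close> over the sets of
  \<open>G\<close>, the form that \<open>real_cond_exp_charact\<close> can use.\<close>

lemma indep_given_iff:
  assumes "subalgebra M C" "subalgebra M G" "subalgebra M H"
  shows "indep_given M C G H \<longleftrightarrow> (\<forall>a\<in>sets G. \<forall>b\<in>sets H. prob (a \<inter> b) =
     (\<integral>x. indicator a x * real_cond_exp M C (indicator b) x \<partial>M))"
  unfolding indep_given_def
  by (intro ball_cong refl arg_cong2[where f="(=)"] indep_given_integral_eq assms subalgebra_sets[OF assms(2)]
    subalgebra_sets[OF assms(3)])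

lemma set_integral_indicator:
  assumes "a \<in> events" "b \<in> events"
  shows "(\<integral>x\<in>a. indicator b x \<partial>M) = (prob (a \<inter> b) :: real)"
proof -
  have "(\<integral>x\<in>a. indicator b x \<partial>M) = (\<integral>x. indicator (a \<inter> b) x \<partial>M :: real)"
    unfolding set_lebesgue_integral_def by (intro Bochner_Integration.integral_cong) (auto simp: indicator_def)
  then show ?thesis using assms by auto
qed

text \<open>Weak union. The conditional probability of \<open>b\<close> given \<open>C0\<close> has
  the right integrals over all sets of \<open>G\<close>, in particular over those of
  \<open>C\<close>; hence it is also a version of the one given \<open>C\<close>.\<close>

lemma indep_given_tower:
  assumes sub: "subalgebra M C0" "subalgebra M C" "subalgebra M G" "subalgebra M H"
    and le: "sets C0 \<subseteq> sets C" "sets C \<subseteq> sets G" and indep_given: "indep_given M C0 G H"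
  shows "indep_given M C G H"
  unfolding indep_given_iff[OF sub(2-4)]
proof (intro ballI)
  fix a b assume ab: "a \<in> sets G" "b \<in> sets H"
  then have ev: "a \<in> events" "b \<in> events" using sub subalgebra_sets by auto
  interpret finite_measure_subalgebra M C using finite_measure_subalgebraI[OF sub(2)] .
  have "AE x in M. real_cond_exp M C (indicator b) x = real_cond_exp M C0 (indicator b) x"
  proof (rule real_cond_exp_charact)
    fix c assume c: "c \<in> sets C"
    then have "(\<integral>x\<in>c. indicator b x \<partial>M) = prob (c \<inter> b)"
      using set_integral_indicator ev subalgebra_sets sub(2) by auto
    also have "\<dots> = (\<integral>x\<in>c. real_cond_exp M C0 (indicator b) x \<partial>M)"
      using indep_given c le ab unfolding indep_given_iff[OF sub(1,3,4)] set_lebesgue_integral_def by auto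
    finally show "(\<integral>x\<in>c. indicator b x \<partial>M) = (\<integral>x\<in>c. real_cond_exp M C0 (indicator b) x \<partial>M)" .
  next
    show "real_cond_exp M C0 (indicator b) \<in> borel_measurable C"
      using sub le by (intro measurable_from_subalg[of C C0]) (auto simp: subalgebra_def)
  qed (use integrable_ind integrable_cond_exp_ind sub ev in auto)
  then have "(\<integral>x. indicator a x * real_cond_exp M C (indicator b) x \<partial>M)
    = (\<integral>x. indicator a x * real_cond_exp M C0 (indicator b) x \<partial>M)"
    using ev by (intro integral_cong_AE) auto
  then show "prob (a \<inter> b) = (\<integral>x. indicator a x * real_cond_exp M C (indicator b) x \<partial>M)"
    using indep_given ab unfolding indep_given_iff[OF sub(1,3,4)] by auto
qed

text \<open>In the asymmetric form \<open>a\<close> enters only through integrals of its indicator,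
  which null sets do not affect. This lets \<open>G\<close> absorb variables that are almost surely
  functions of \<open>G0\<close>.\<close>

lemma indep_given_AE_eq:
  assumes sub: "subalgebra M C" "subalgebra M G0" "subalgebra M G" "subalgebra M H"
    and indep_given: "indep_given M C G0 H"
    and eq: "\<And>a. a \<in> sets G \<Longrightarrow> \<exists>a0\<in>sets G0. AE x in M. x \<in> a \<longleftrightarrow> x \<in> a0"
  shows "indep_given M C G H"
  unfolding indep_given_iff[OF sub(1,3,4)]
proof (intro ballI)
  fix a b assume ab: "a \<in> sets G" "b \<in> sets H"
  obtain a0 where a0: "a0 \<in> sets G0" "AE x in M. x \<in> a \<longleftrightarrow> x \<in> a0" using eq[OF ab(1)] by blast
  have ev: "a \<in> events" "b \<in> events" "a0 \<in> events" using ab a0 sub subalgebra_sets by auto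
  have "prob (a \<inter> b) = prob (a0 \<inter> b)"
    using a0(2) ev by (intro finite_measure_eq_AE) auto
  also have "\<dots> = (\<integral>x. indicator a0 x * real_cond_exp M C (indicator b) x \<partial>M)"
    using indep_given a0(1) ab(2) unfolding indep_given_iff[OF sub(1,2,4)] by auto
  also have "\<dots> = (\<integral>x. indicator a x * real_cond_exp M C (indicator b) x \<partial>M)"
    using ev a0(2) by (intro integral_cong_AE) (auto simp: indicator_def)
  finally show "prob (a \<inter> b) = (\<integral>x. indicator a x * real_cond_exp M C (indicator b) x \<partial>M)" .
qed

text \<open>Independence of \<open>G\<close> makes the conditional probability of \<open>b\<close>
  given \<open>C\<close> the constant \<open>prob b\<close>.\<close>

lemma indep_given_indep:
  assumes sub: "subalgebra M C" "subalgebra M G" "subalgebra M H"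
    and le: "sets C \<subseteq> sets G"
    and indep: "\<And>a b. a \<in> sets G \<Longrightarrow> b \<in> sets H \<Longrightarrow> prob (a \<inter> b) = prob a * prob b"
  shows "indep_given M C G H"
  unfolding indep_given_iff[OF sub]
proof (intro ballI)
  fix a b assume ab: "a \<in> sets G" "b \<in> sets H"
  then have ev: "a \<in> events" "b \<in> events" using sub subalgebra_sets by auto
  interpret finite_measure_subalgebra M C using finite_measure_subalgebraI[OF sub(1)] .
  have "AE x in M. real_cond_exp M C (indicator b) x = prob b"
  proof (rule real_cond_exp_charact)
    fix c assume c: "c \<in> sets C"
    then have "c \<in> events" using subalgebra_sets sub(1) by auto
    then show "(\<integral>x\<in>c. indicator b x \<partial>M) = (\<integral>x\<in>c. prob b \<partial>M)"
      using set_integral_indicator[OF _ ev(2), of c] indep[of c b] c le ab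
      by (auto simp: set_lebesgue_integral_def)
  qed (use integrable_ind ev in auto)
  then have "(\<integral>x. indicator a x * real_cond_exp M C (indicator b) x \<partial>M) = (\<integral>x. indicator a x * prob b \<partial>M)"
    using ev by (intro integral_cong_AE) auto
  then show "prob (a \<inter> b) = (\<integral>x. indicator a x * real_cond_exp M C (indicator b) x \<partial>M)"
    using indep[OF ab] ev by simp
qed

text \<open>Since \<open>C\<close> is part of \<open>G\<close>, the set \<open>c \<inter> a\<close>
  may be tested instead of \<open>a\<close>. This recovers the integrals over sets of
  \<open>C\<close> from a definition that integrates over the whole space.\<close>

lemma indep_given_factor:
  assumes sub: "subalgebra M C" "subalgebra M G" "subalgebra M H"
    and le: "sets C \<subseteq> sets G" and indep_given: "indep_given M C G H"
    and abc: "a \<in> sets G" "b \<in> sets H" "c \<in> sets C"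
  shows "prob (c \<inter> (a \<inter> b)) =
    (\<integral>x. indicator c x * (real_cond_exp M C (indicator a) x * real_cond_exp M C (indicator b) x) \<partial>M)"
proof -
  have ev: "a \<in> events" "b \<in> events" "c \<in> events" using abc sub subalgebra_sets by auto
  have "prob (c \<inter> (a \<inter> b)) = prob ((c \<inter> a) \<inter> b)" by (simp add: Int_assoc)
  also have "\<dots> = (\<integral>x. indicator (c \<inter> a) x * real_cond_exp M C (indicator b) x \<partial>M)"
    using indep_given abc le unfolding indep_given_iff[OF sub] by auto
  also have "\<dots> = (\<integral>x. (indicator c x * real_cond_exp M C (indicator b) x) * indicator a x \<partial>M)"
    by (intro Bochner_Integration.integral_cong) (auto simp: indicator_def)
  also have "\<dots> = (\<integral>x. (indicator c x * real_cond_exp M C (indicator b) x) * real_cond_exp M C (indicator a) x \<partial>M)"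
    using abc ev integrable_ind_mult[OF integrable_cond_exp_ind[OF sub(1) ev(2)] ev(3)]
    by (intro cond_exp_selfadjoint(2)[OF sub(1)]) auto
  finally show ?thesis by (simp add: ac_simps)
qed

lemma indep_given_imp_cond_exp_product:
  assumes sub: "subalgebra M C" "subalgebra M G" "subalgebra M H"
    and le: "sets C \<subseteq> sets G" and indep_given: "indep_given M C G H"
    and ab: "a \<in> sets G" "b \<in> sets H"
  shows "AE x in M. real_cond_exp M C (indicator (a \<inter> b)) x =
    real_cond_exp M C (indicator a) x * real_cond_exp M C (indicator b) x"
proof -
  have ev: "a \<in> events" "b \<in> events" using ab sub subalgebra_sets by auto
  interpret finite_measure_subalgebra M C using finite_measure_subalgebraI[OF sub(1)] .
  show ?thesis
  proof (rule real_cond_exp_charact)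
    fix c assume c: "c \<in> sets C"
    have "c \<in> events" using c sub(1) subalgebra_sets by auto
    then show "(\<integral>x\<in>c. indicator (a \<inter> b) x \<partial>M) =
      (\<integral>x\<in>c. real_cond_exp M C (indicator a) x * real_cond_exp M C (indicator b) x \<partial>M)"
      using set_integral_indicator[of c "a \<inter> b"] ev indep_given_factor[OF sub le indep_given ab c]
      by (auto simp: set_lebesgue_integral_def)
  next
    show "integrable M (indicator (a \<inter> b) :: _ \<Rightarrow> real)" using ev integrable_ind by auto
    show "integrable M (\<lambda>x. real_cond_exp M C (indicator a) x * real_cond_exp M C (indicator b) x)"
      using ev by (intro cond_exp_selfadjoint integrable_cond_exp_ind sub(1)) auto
  qed auto
qed

text \<open>For fixed \<open>a\<close>, both \<open>prob (a \<inter> d)\<close> and the integral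
  over \<open>d\<close> of the conditional probability of \<open>a\<close> are finite measures in
  \<open>d\<close>. They agree on the sets \<open>b \<inter> c\<close> by
  \<open>indep_given_factor\<close>, hence on the generated algebra by Dynkin's theorem.\<close>

lemma indep_given_join_right:
  assumes sub: "subalgebra M C" "subalgebra M G" "subalgebra M H" "subalgebra M H'"
    and le: "sets C \<subseteq> sets G" and indep_given: "indep_given M C G H"
    and gen: "sets H' \<subseteq> sigma_sets (space M) {b \<inter> c | b c. b \<in> sets H \<and> c \<in> sets C}"
  shows "indep_given M C G H'"
proof -
  let ?gen = "{b \<inter> c | b c. b \<in> sets H \<and> c \<in> sets C}"
  have genM: "?gen \<subseteq> events" using sub subalgebra_sets by blast
  then have sM: "sigma_sets (space M) ?gen \<subseteq> events" by (rule sets.sigma_sets_subset)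
  have stable: "Int_stable ?gen"
  proof (rule Int_stableI)
    fix x y assume "x \<in> ?gen" "y \<in> ?gen"
    then obtain b c b' c' where "x = b \<inter> c" "y = b' \<inter> c'" "b \<in> sets H" "c \<in> sets C" "b' \<in> sets H" "c' \<in> sets C"
      by blast
    then have "x \<inter> y = (b \<inter> b') \<inter> (c \<inter> c')" "b \<inter> b' \<in> sets H" "c \<inter> c' \<in> sets C" by auto
    then show "x \<inter> y \<in> ?gen" by blast
  qed
  have "prob (a \<inter> d) = (\<integral>x\<in>d. real_cond_exp M C (indicator a) x \<partial>M)"
    if a: "a \<in> sets G" and d: "d \<in> sigma_sets (space M) ?gen" for a d
  proof -
    have ev: "a \<in> events" using a sub subalgebra_sets by auto
    have int: "integrable M (real_cond_exp M C (indicator a))"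
      using integrable_cond_exp_ind[OF sub(1) ev] .
    \<comment> \<open>The total mass, needed to pass to complements.\<close>
    have whole: "(\<integral>x\<in>space M. real_cond_exp M C (indicator a) x \<partial>M) = prob a"
    proof -
      interpret finite_measure_subalgebra M C using finite_measure_subalgebraI[OF sub(1)] .
      have "(\<integral>x\<in>space M. real_cond_exp M C (indicator a) x \<partial>M) = (\<integral>x. real_cond_exp M C (indicator a) x \<partial>M)"
        using set_integral_space[OF int] by simp
      also have "\<dots> = prob a" using real_cond_exp_int(2)[OF integrable_ind[OF ev]] ev by simp
      finally show ?thesis .
    qed
    show ?thesis
    proof (rule sigma_sets_induct_disjoint[OF stable _ d])
      show "?gen \<subseteq> Pow (space M)" using genM sets.space_closed by blast
    next
      fix e assume "e \<in> ?gen"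
      then obtain b c where bc: "e = b \<inter> c" "b \<in> sets H" "c \<in> sets C" by blast
      have ev': "b \<in> events" "c \<in> events" using bc sub subalgebra_sets by auto
      have "prob (a \<inter> e) = prob (c \<inter> (a \<inter> b))" unfolding bc by (simp add: ac_simps)
      also have "\<dots> = (\<integral>x. (indicator c x * real_cond_exp M C (indicator a) x) * real_cond_exp M C (indicator b) x \<partial>M)"
        using indep_given_factor[OF sub(1-3) le indep_given a bc(2,3)] by (simp add: ac_simps)
      also have "\<dots> = (\<integral>x. (indicator c x * real_cond_exp M C (indicator a) x) * indicator b x \<partial>M)"
        using bc ev' integrable_ind_mult[OF int ev'(2)]
        by (intro cond_exp_selfadjoint(2)[symmetric] sub(1)) auto
      also have "\<dots> = (\<integral>x\<in>e. real_cond_exp M C (indicator a) x \<partial>M)"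
        unfolding set_lebesgue_integral_def bc
        by (intro Bochner_Integration.integral_cong) (auto simp: indicator_def)
      finally show "prob (a \<inter> e) = (\<integral>x\<in>e. real_cond_exp M C (indicator a) x \<partial>M)" .
    next
      show "prob (a \<inter> {}) = (\<integral>x\<in>{}. real_cond_exp M C (indicator a) x \<partial>M)"
        by (simp add: set_lebesgue_integral_def)
    next
      fix e assume e: "e \<in> sigma_sets (space M) ?gen"
        "prob (a \<inter> e) = (\<integral>x\<in>e. real_cond_exp M C (indicator a) x \<partial>M)"
      then have eM: "e \<in> events" using sM by auto
      have "a \<inter> (space M - e) = a - a \<inter> e" using sets.sets_into_space[OF ev] by auto
      then have "prob (a \<inter> (space M - e)) = prob a - prob (a \<inter> e)"
        using ev eM by (simp add: finite_measure_Diff)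
      also have "prob a = (\<integral>x\<in>e \<union> (space M - e). real_cond_exp M C (indicator a) x \<partial>M)"
        using whole sets.sets_into_space[OF eM] by (simp add: Un_absorb1)
      also have "\<dots> = (\<integral>x\<in>e. real_cond_exp M C (indicator a) x \<partial>M)
        + (\<integral>x\<in>space M - e. real_cond_exp M C (indicator a) x \<partial>M)"
        using int eM by (intro set_integral_Un)
          (auto simp: set_integrable_def intro!: integrable_ind_mult)
      finally show "prob (a \<inter> (space M - e)) = (\<integral>x\<in>space M - e. real_cond_exp M C (indicator a) x \<partial>M)"
        using e(2) by simp
    next
      fix e :: "nat \<Rightarrow> _" assume e: "disjoint_family e" "range e \<subseteq> sigma_sets (space M) ?gen"
        "\<And>i. prob (a \<inter> e i) = (\<integral>x\<in>e i. real_cond_exp M C (indicator a) x \<partial>M)"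
      have eM: "e i \<in> events" for i using e(2) sM by auto
      have "(\<lambda>i. prob (a \<inter> e i)) sums prob (\<Union>i. a \<inter> e i)"
        using e(1) eM ev by (intro finite_measure_UNION) (auto simp: disjoint_family_on_def)
      then have "prob (a \<inter> (\<Union>i. e i)) = (\<Sum>i. prob (a \<inter> e i))"
        unfolding Int_UN_distrib by (rule sums_unique)
      also have "\<dots> = (\<integral>x\<in>(\<Union>i. e i). real_cond_exp M C (indicator a) x \<partial>M)"
        unfolding e(3)
      proof (intro lebesgue_integral_countable_add[symmetric])
        show "set_integrable M (\<Union>i. e i) (real_cond_exp M C (indicator a))"
          unfolding set_integrable_def real_scaleR_def using int eM by (intro integrable_ind_mult) auto
      qed (use e(1) eM in \<open>auto simp: disjoint_family_on_def\<close>)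
      finally show "prob (a \<inter> (\<Union>i. e i)) = (\<integral>x\<in>(\<Union>i. e i). real_cond_exp M C (indicator a) x \<partial>M)" .
    qed
  qed
  note eq = this
  \<comment> \<open>With the sides exchanged, the asymmetric form is exactly the equation just
    obtained.\<close>
  have "indep_given M C H' G"
    unfolding indep_given_iff[OF sub(1,4,2)]
  proof (intro ballI)
    fix d a assume "d \<in> sets H'" "a \<in> sets G"
    then have "prob (a \<inter> d) = (\<integral>x\<in>d. real_cond_exp M C (indicator a) x \<partial>M)"
      using gen eq by blast
    then show "prob (d \<inter> a) = (\<integral>x. indicator d x * real_cond_exp M C (indicator a) x \<partial>M)"
      by (simp only: set_lebesgue_integral_def real_scaleR_def Int_commute)
  qed
  then show ?thesis by (rule indep_given_sym)
qed

end

section \<open>Separating covers\<close>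

text \<open>Matches the conditioning algebra that \<open>gdgmp\<close> passes to
  \<open>cond_indep\<close>, so the final goal can be folded into it.\<close>

definition coord_algebra :: "('v \<Rightarrow> 'a) measure \<Rightarrow> ('v \<Rightarrow> 'a measure) \<Rightarrow> 'v set \<Rightarrow> ('v \<Rightarrow> 'a) measure" where
  "coord_algebra Q Xsp S = vimage_algebra (space Q) (\<lambda>x. restrict x S) (PiM S Xsp)"

locale coord_prob_space = prob_space Q for Q :: "('v \<Rightarrow> 'a) measure" +
  fixes V :: "'v set" and Xsp :: "'v \<Rightarrow> 'a measure"
  assumes sets_Q: "sets Q = sets (PiM V Xsp)"
begin

abbreviation coord :: "'v set \<Rightarrow> ('v \<Rightarrow> 'a) measure" where
  "coord \<equiv> coord_algebra Q Xsp"

lemma space_Q: "space Q = space (PiM V Xsp)"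
  using sets_Q by (rule sets_eq_imp_space_eq)

lemma measurable_restrict_coord:
  assumes "S \<subseteq> V" shows "(\<lambda>x. restrict x S) \<in> Q \<rightarrow>\<^sub>M PiM S Xsp"
  using measurable_restrict_subset[OF assms, of Xsp] measurable_cong_sets[OF sets_Q refl] by auto

lemma sets_coord:
  assumes "S \<subseteq> V"
  shows "sets (coord S) = {(\<lambda>x. restrict x S) -` E \<inter> space Q | E. E \<in> sets (PiM S Xsp)}"
  unfolding coord_algebra_def
  using measurable_space[OF measurable_restrict_coord[OF assms]] by (intro sets_vimage_algebra2) auto

lemma vimage_in_coord:
  assumes "S \<subseteq> V" "E \<in> sets (PiM S Xsp)"
  shows "(\<lambda>x. restrict x S) -` E \<inter> space Q \<in> sets (coord S)"
  using assms by (auto simp: sets_coord)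

lemma subalgebra_coord:
  assumes "S \<subseteq> V" shows "subalgebra Q (coord S)"
  using measurable_sets[OF measurable_restrict_coord[OF assms]]
  by (auto simp: subalgebra_def sets_coord[OF assms]) (auto simp: coord_algebra_def)

lemma sets_coord_mono:
  assumes "S \<subseteq> T" "T \<subseteq> V" shows "sets (coord S) \<subseteq> sets (coord T)"
proof
  fix a assume "a \<in> sets (coord S)"
  then obtain E where E: "E \<in> sets (PiM S Xsp)" "a = (\<lambda>x. restrict x S) -` E \<inter> space Q"
    using assms by (auto simp: sets_coord)
  have "a = (\<lambda>x. restrict x T) -` ((\<lambda>x. restrict x S) -` E \<inter> space (PiM T Xsp)) \<inter> space Q"
    using measurable_space[OF measurable_restrict_coord[OF assms(2)]] assms(1)
    unfolding E by (auto simp: Int_absorb1)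
  then show "a \<in> sets (coord T)"
    using vimage_in_coord[OF assms(2) measurable_sets[OF measurable_restrict_subset[OF assms(1)] E(1)]]
    by simp
qed

text \<open>Measurability into a product is checked on single coordinates. An event of one
  coordinate belongs to one of the two algebras and becomes a generator after intersection with
  \<open>space Q\<close>.\<close>

lemma sets_coord_Un:
  assumes "S \<subseteq> V" "T \<subseteq> V"
  shows "sets (coord (S \<union> T)) \<subseteq> sigma_sets (space Q) {b \<inter> c | b c. b \<in> sets (coord S) \<and> c \<in> sets (coord T)}"
    (is "_ \<subseteq> sigma_sets _ ?gen")
proof -
  have gen: "?gen \<subseteq> Pow (space Q)" by (auto simp: sets_coord assms)
  have top: "space Q \<in> sets (coord S)" "space Q \<in> sets (coord T)"
    using sets.top[of "coord S"] sets.top[of "coord T"] by (auto simp: coord_algebra_def)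
  have "(\<lambda>x. restrict x (S \<union> T)) \<in> sigma (space Q) ?gen \<rightarrow>\<^sub>M PiM (S \<union> T) Xsp"
  proof (rule measurable_restrict)
    fix i assume i: "i \<in> S \<union> T"
    have coord: "(\<lambda>x. x i) -` E \<inter> space Q \<in> sets (coord R)"
      if R: "i \<in> R" "R \<subseteq> V" and E: "E \<in> sets (Xsp i)" for E R
    proof -
      have "(\<lambda>x. x i) -` E \<inter> space Q = (\<lambda>x. restrict x R) -` ((\<lambda>x. x i) -` E \<inter> space (PiM R Xsp)) \<inter> space Q"
        using measurable_space[OF measurable_restrict_coord[OF R(2)]] R(1) by auto
      then show ?thesis
        using vimage_in_coord[OF R(2) measurable_sets[OF measurable_component_singleton[OF R(1), of Xsp] E]]
        by simp
    qed
    show "(\<lambda>x. x i) \<in> sigma (space Q) ?gen \<rightarrow>\<^sub>M Xsp i"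
    proof (rule measurableI)
      fix x assume "x \<in> space (sigma (space Q) ?gen)"
      then show "x i \<in> space (Xsp i)"
        using i assms gen unfolding space_measure_of[OF gen] space_Q by (auto simp: space_PiM PiE_iff)
    next
      fix E assume E: "E \<in> sets (Xsp i)"
      let ?e = "(\<lambda>x. x i) -` E \<inter> space Q"
      have "?e \<in> sets (coord S) \<or> ?e \<in> sets (coord T)" using i coord assms E by blast
      moreover have "?e = ?e \<inter> space Q" "?e = space Q \<inter> ?e" by auto
      ultimately have "?e \<in> ?gen" using top by blast
      then show "(\<lambda>x. x i) -` E \<inter> space (sigma (space Q) ?gen) \<in> sets (sigma (space Q) ?gen)"
        using gen by (auto simp: space_measure_of sets_measure_of)
    qed
  qed
  from measurable_sets[OF this] show ?thesis
    using gen assms by (auto simp: sets_coord space_measure_of sets_measure_of)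
qed

lemma indep_given_coord_join_right:
  assumes "indep_given Q (coord C) (coord G) (coord H)" "C \<subseteq> G" "G \<subseteq> V" "H \<subseteq> V"
  shows "indep_given Q (coord C) (coord G) (coord (H \<union> C))"
  using assms by (intro indep_given_join_right[OF _ _ _ _ _ assms(1)] sets_coord_Un subalgebra_coord sets_coord_mono) auto

end

text \<open>Take \<open>k\<close> outside \<open>W\<close> with the fewest descendants in
  \<open>U\<close>. A descendant of \<open>k\<close> in \<open>U\<close> stays outside
  \<open>W\<close> and has no more descendants than \<open>k\<close>, hence the same ones, among
  them \<open>k\<close>.\<close>

lemma finite_terminal_node:
  assumes "finite U" "k0 \<in> U" "\<And>k y. k \<notin> W \<Longrightarrow> (k, y) \<in> D \<Longrightarrow> y \<notin> W" "k0 \<notin> W"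
  shows "\<exists>k\<in>U - W. \<forall>y\<in>U. (k, y) \<in> D\<^sup>* \<longrightarrow> (y, k) \<in> D\<^sup>*"
proof -
  define d where "d k = {y \<in> U. (k, y) \<in> D\<^sup>*}" for k
  obtain k where k: "k \<in> U - W" "\<And>y. y \<in> U - W \<Longrightarrow> card (d k) \<le> card (d y)"
    using ex_has_least_nat[of "\<lambda>k. k \<in> U - W" k0 "\<lambda>k. card (d k)"] assms(2,4) by blast
  have "(y, k) \<in> D\<^sup>*" if y: "y \<in> U" "(k, y) \<in> D\<^sup>*" for y
  proof -
    have "y \<notin> W" using y(2) by induction (use k(1) assms(3) in auto)
    moreover have "d y \<subseteq> d k" using y unfolding d_def by (auto intro: rtrancl_trans)
    moreover have "finite (d k)" using assms(1) unfolding d_def by auto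
    ultimately have "d y = d k" using k(2)[of y] y(1) by (intro card_seteq) auto
    then show ?thesis using k(1) unfolding d_def by auto
  qed
  then show ?thesis using k(1) by blast
qed

text \<open>The graph is abstract here: it is tied to the probability only through
  \<open>indep\<close> and \<open>determined\<close>.\<close>

theorem (in coord_prob_space) indep_given_of_cover:
  assumes V: "finite V" and D: "D \<subseteq> V \<times> V" and W: "\<And>v w. (v, w) \<in> D \<Longrightarrow> w \<notin> W"
    and indep: "\<And>S T a b. S \<subseteq> W \<Longrightarrow> T \<subseteq> W \<Longrightarrow> S \<inter> T = {} \<Longrightarrow> a \<in> sets (coord S) \<Longrightarrow> b \<in> sets (coord T) \<Longrightarrow>
      prob (a \<inter> b) = prob a * prob b"
    and determined: "\<And>k G a. k \<in> V - W \<Longrightarrow> scc_family V D k \<subseteq> G \<Longrightarrow> G \<subseteq> V \<Longrightarrow> a \<in> sets (coord G) \<Longrightarrow>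
      \<exists>a0\<in>sets (coord (G - scc_of V D k)). AE x in Q. x \<in> a \<longleftrightarrow> x \<in> a0"
    and GH: "G \<subseteq> V" "H \<subseteq> V"
    and cover: "\<And>k. k \<in> G \<union> H - W \<Longrightarrow> scc_family V D k \<subseteq> G \<or> scc_family V D k \<subseteq> H"
  shows "indep_given Q (coord (G \<inter> H)) (coord G) (coord H)"
  using GH cover
proof (induction "card (G \<union> H - W)" arbitrary: G H rule: less_induct)
  case less
  show ?case
  proof (cases "G \<union> H \<subseteq> W")
    case True
    \<comment> \<open>Independence speaks of disjoint sets of coordinates only, so the overlap is
      removed from \<open>H\<close> first and joined again afterwards.\<close>
    have "indep_given Q (coord (G \<inter> H)) (coord G) (coord (H - G))"
      using True less.prems(1,2)
      by (intro indep_given_indep subalgebra_coord sets_coord_mono indep[of G "H - G"]) auto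
    from indep_given_coord_join_right[OF this] less.prems(1,2) have
      "indep_given Q (coord (G \<inter> H)) (coord G) (coord ((H - G) \<union> (G \<inter> H)))" by auto
    also have "(H - G) \<union> (G \<inter> H) = H" by auto
    finally show ?thesis .
  next
    case False
    have fin: "finite (G \<union> H)" using V less.prems(1,2) by (auto intro: finite_subset)
    from False finite_terminal_node[OF fin, of _ W D] W obtain k where k: "k \<in> G \<union> H - W"
      "\<And>y. y \<in> G \<union> H \<Longrightarrow> (k, y) \<in> D\<^sup>* \<Longrightarrow> (y, k) \<in> D\<^sup>*" by (metis DiffE DiffI subsetI)
    define K where "K = scc_of V D k"
    have kV: "k \<in> V - W" "k \<in> K" using k(1) less.prems(1,2) unfolding K_def scc_of_def by auto
    \<comment> \<open>Stated for arbitrary sides, since the family of \<open>k\<close> may lie in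
      \<open>G\<close> or in \<open>H\<close>.\<close>
    have step: "indep_given Q (coord (G' \<inter> H')) (coord G') (coord H')"
      if *: "G' \<union> H' = G \<union> H" "scc_family V D k \<subseteq> G'"
        "\<And>k. k \<in> G' \<union> H' - W \<Longrightarrow> scc_family V D k \<subseteq> G' \<or> scc_family V D k \<subseteq> H'" for G' H'
    proof -
      have sub: "G' \<subseteq> V" "H' \<subseteq> V" "K \<subseteq> G'"
        using * less.prems(1,2) unfolding K_def scc_family_def by auto
      have "indep_given Q (coord ((G' - K) \<inter> (H' - K))) (coord (G' - K)) (coord (H' - K))"
      proof (rule less.hyps)
        show "card ((G' - K) \<union> (H' - K) - W) < card (G \<union> H - W)"
          using fin k(1) kV(2) *(1) by (intro psubset_card_mono) auto
        fix k' assume k': "k' \<in> (G' - K) \<union> (H' - K) - W"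
        \<comment> \<open>Otherwise \<open>k'\<close> would be a descendant of \<open>k\<close>, and
          terminality would put it into \<open>K\<close>. So removing \<open>K\<close> does not
          damage the cover of the remaining nodes.\<close>
        have "scc_family V D k' \<inter> K = {}"
        proof (rule ccontr)
          assume "scc_family V D k' \<inter> K \<noteq> {}"
          then obtain x where "x \<in> scc_family V D k'" "x \<in> K" by blast
          then have "(x, k') \<in> D\<^sup>*" "(k, x) \<in> D\<^sup>*"
            unfolding scc_family_def scc_of_def K_def by (auto intro: converse_rtrancl_into_rtrancl)
          then have "(k, k') \<in> D\<^sup>*" by (rule rtrancl_trans[rotated])
          with k(2)[of k'] k' *(1) sub have "k' \<in> K" unfolding K_def scc_of_def by auto
          with k' show False by auto
        qed
        with *(3)[of k'] k' show "scc_family V D k' \<subseteq> G' - K \<or> scc_family V D k' \<subseteq> H' - K" by blast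
      qed (use sub in auto)
      \<comment> \<open>\<open>K\<close> returns to the left side: up to null sets it adds no events
        there.\<close>
      then have "indep_given Q (coord ((G' - K) \<inter> (H' - K))) (coord G') (coord (H' - K))"
      proof (rule indep_given_AE_eq[rotated 4])
        fix a assume "a \<in> sets (coord G')"
        then show "\<exists>a0\<in>sets (coord (G' - K)). AE x in Q. x \<in> a \<longleftrightarrow> x \<in> a0"
          using determined[OF kV(1) *(2) sub(1)] unfolding K_def by blast
      qed (use sub in \<open>auto intro!: subalgebra_coord\<close>)
      \<comment> \<open>The left side contains \<open>K\<close> again, so the conditioning may grow
        by \<open>K \<inter> H'\<close>; joining it to the right side then restores
        \<open>H'\<close>.\<close>
      then have "indep_given Q (coord (G' \<inter> H')) (coord G') (coord (H' - K))"
        using sub by (elim indep_given_tower[rotated 6]; intro subalgebra_coord sets_coord_mono) auto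
      from indep_given_coord_join_right[OF this] sub have
        "indep_given Q (coord (G' \<inter> H')) (coord G') (coord ((H' - K) \<union> (G' \<inter> H')))" by auto
      also have "(H' - K) \<union> (G' \<inter> H') = H'" using sub by auto
      finally show ?thesis .
    qed
    from less.prems(3)[OF k(1)] show ?thesis
    proof
      assume "scc_family V D k \<subseteq> G"
      then show ?thesis using step[of G H] less.prems(3) by auto
    next
      assume "scc_family V D k \<subseteq> H"
      then have "indep_given Q (coord (H \<inter> G)) (coord H) (coord G)"
        using step[of H G] less.prems(3) by (auto simp: Un_commute)
      then show ?thesis by (metis indep_given_sym Int_commute)
    qed
  qed
qed

section \<open>Matched systems of constraints\<close>

text \<open>The directed edges of the marginalized graph as a relation on bare variables; each runs
  through the constraint matched to its head.\<close>

definition constraint_edges :: "'f set \<Rightarrow> ('f \<Rightarrow> 'v set) \<Rightarrow> ('v \<times> 'f) set \<Rightarrow> ('v \<times> 'v) set" where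
  "constraint_edges F Vf M = {(v, w). \<exists>f\<in>F. v \<in> Vf f \<and> (v, f) \<notin> M \<and> (w, f) \<in> M}"

lemma rtrancl_map_Inl:
  "(Inl v, Inl w) \<in> (map_prod Inl Inl ` R)\<^sup>* \<longleftrightarrow> (v, w) \<in> R\<^sup>*"
proof
  have "\<exists>w. y = Inl w \<and> (v, w) \<in> R\<^sup>*" if "(Inl v, y) \<in> (map_prod Inl Inl ` R)\<^sup>*" for y
    using that by induction (auto intro: rtrancl.rtrancl_into_rtrancl)
  then show "(Inl v, Inl w) \<in> (map_prod Inl Inl ` R)\<^sup>* \<Longrightarrow> (v, w) \<in> R\<^sup>*" by blast
  show "(v, w) \<in> R\<^sup>* \<Longrightarrow> (Inl v, Inl w) \<in> (map_prod Inl Inl ` R)\<^sup>*"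
    by (induction rule: rtrancl_induct) (auto intro: rtrancl.rtrancl_into_rtrancl)
qed

lemma scc_of_map_Inl:
  "scc_of (Inl ` V) (map_prod Inl Inl ` R) (Inl v) = Inl ` scc_of V R v"
  unfolding scc_of_def by (auto simp: rtrancl_map_Inl)

lemma scc_family_map_Inl:
  "scc_family (Inl ` V) (map_prod Inl Inl ` R) (Inl v) = Inl ` scc_family V R v"
  unfolding scc_family_def scc_of_map_Inl image_Un by (intro arg_cong2[where f="(\<union>)"] refl) auto

locale matched_constraints =
  fixes V W :: "'v set" and F :: "'f set" and Vf :: "'f \<Rightarrow> 'v set" and M :: "('v \<times> 'f) set"
  assumes match: "perfect_matching_induced V W F Vf M"
    and Vf_subset: "f \<in> F \<Longrightarrow> Vf f \<subseteq> V"
begin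

abbreviation "edges \<equiv> constraint_edges F Vf M"

lemma matchD:
  assumes "(v, f) \<in> M" shows "f \<in> F" "v \<in> Vf f" "v \<in> V - W"
  using assms match Vf_subset unfolding perfect_matching_induced_def by auto

lemma match_unique: "(v, f) \<in> M \<Longrightarrow> (w, f) \<in> M \<Longrightarrow> v = w"
  using match matchD(1) unfolding perfect_matching_induced_def by blast

lemma match_exists: "v \<in> V - W \<Longrightarrow> \<exists>f. (v, f) \<in> M"
  using match unfolding perfect_matching_induced_def by blast

lemma edges_subset: "edges \<subseteq> V \<times> V"
  using Vf_subset unfolding constraint_edges_def by (auto dest: matchD)

lemma edges_avoid_W: "(v, w) \<in> edges \<Longrightarrow> w \<notin> W"
  unfolding constraint_edges_def by (auto dest: matchD)

lemma GBM_simps: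
  "(Inl v, y) \<in> GBM F Vf M \<longleftrightarrow> (\<exists>f\<in>F. y = Inr f \<and> v \<in> Vf f \<and> (v, f) \<notin> M)"
  "(Inr f, y) \<in> GBM F Vf M \<longleftrightarrow> (\<exists>v. y = Inl v \<and> (v, f) \<in> M)"
  unfolding GBM_def by (auto dest: matchD)

text \<open>The graph is bipartite, so a directed path between variables whose inner vertices are
  all constraints has exactly one inner vertex.\<close>

lemma mar_dir_eq:
  "mar_dir (Gnodes V F) (GBM F Vf M) (Inr ` F) = map_prod Inl Inl ` edges"
proof -
  let ?D = "GBM F Vf M" and ?U = "Inr ` F"
  have nodes: "Gnodes V F - ?U = Inl ` V" unfolding Gnodes_def by auto
  have reach: "z = Inl v \<or> (\<exists>f\<in>F. z = Inr f \<and> v \<in> Vf f \<and> (v, f) \<notin> M)"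
    if "(Inl v, z) \<in> (?D O Id_on ?U)\<^sup>*" for v z
    using that by induction (auto simp: GBM_simps)
  have "(Inl v, Inl w) \<in> path_through ?D ?U \<longleftrightarrow> (v, w) \<in> edges" for v w
  proof
    assume "(Inl v, Inl w) \<in> path_through ?D ?U"
    then obtain z where "(Inl v, z) \<in> (?D O Id_on ?U)\<^sup>*" "(z, Inl w) \<in> ?D"
      unfolding path_through_def by auto
    with reach[of v z] show "(v, w) \<in> edges" by (auto simp: GBM_simps constraint_edges_def)
  next
    assume "(v, w) \<in> edges"
    then obtain f where "f \<in> F" "v \<in> Vf f" "(v, f) \<notin> M" "(w, f) \<in> M"
      unfolding constraint_edges_def by auto
    then have "(Inl v, Inr f) \<in> ?D" "(Inr f, Inr f) \<in> Id_on ?U" "(Inr f, Inl w) \<in> ?D"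
      by (auto simp: GBM_simps)
    then show "(Inl v, Inl w) \<in> path_through ?D ?U"
      unfolding path_through_def by (meson r_into_rtrancl relcomp.relcompI)
  qed
  then show ?thesis unfolding mar_dir_def nodes using edges_subset by auto
qed

lemma sigma_separated_mar_cover:
  assumes ABC: "A \<subseteq> V" "B \<subseteq> V" "C \<subseteq> V"
    and sep: "sigma_separated (Inl ` V) (mar_dir (Gnodes V F) (GBM F Vf M) (Inr ` F)) Bi
      (Inl ` A) (Inl ` B) (Inl ` C)"
  shows "\<exists>G H. G \<inter> H = C \<and> A \<subseteq> G \<and> B \<subseteq> H \<and> G \<subseteq> V \<and> H \<subseteq> V \<and>
    (\<forall>k\<in>G \<union> H. scc_family V edges k \<subseteq> G \<or> scc_family V edges k \<subseteq> H)"
proof -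
  let ?i = "Inl :: 'v \<Rightarrow> 'v + 'f"
  let ?D = "map_prod ?i ?i ` edges"
  have images: "?D \<subseteq> ?i ` V \<times> ?i ` V" "?i ` A \<subseteq> ?i ` V" "?i ` B \<subseteq> ?i ` V" "?i ` C \<subseteq> ?i ` V"
    using edges_subset ABC by auto
  obtain G' H' where "G' \<inter> H' = ?i ` C" "?i ` A \<subseteq> G'" "?i ` B \<subseteq> H'" "G' \<subseteq> ?i ` V" "H' \<subseteq> ?i ` V"
    and cover: "\<And>k. k \<in> G' \<union> H' \<Longrightarrow> scc_family (?i ` V) ?D k \<subseteq> G' \<or> scc_family (?i ` V) ?D k \<subseteq> H'"
    using sigma_separated_cover[OF images sep[unfolded mar_dir_eq]] by metis
  moreover from this obtain G H where GH: "G' = ?i ` G" "H' = ?i ` H"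
    by (metis subset_imageE)
  moreover have inj: "?i ` S \<subseteq> ?i ` T \<longleftrightarrow> S \<subseteq> T" for S T by auto
  moreover have "scc_family V edges k \<subseteq> G \<or> scc_family V edges k \<subseteq> H" if "k \<in> G \<union> H" for k
    using cover[of "Inl k"] that unfolding GH by (auto simp: scc_family_map_Inl inj)
  moreover have "G \<inter> H = C" using calculation(1) unfolding GH by auto
  ultimately show ?thesis by (intro exI[of _ G] exI[of _ H]) auto
qed

lemma GBM_reach: "(Inl v, Inl w) \<in> (GBM F Vf M)\<^sup>* \<longleftrightarrow> (v, w) \<in> edges\<^sup>*"
proof
  \<comment> \<open>For the induction to pass through a constraint, it must remember the variable
    from which the constraint was entered.\<close>
  have "(\<forall>w. y = Inl w \<longrightarrow> (v, w) \<in> edges\<^sup>*) \<and>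
    (\<forall>f. y = Inr f \<longrightarrow> (\<exists>u\<in>Vf f. f \<in> F \<and> (v, u) \<in> edges\<^sup>* \<and> (u, f) \<notin> M))"
    if "(Inl v, y) \<in> (GBM F Vf M)\<^sup>*" for y
    using that
  proof induction
    case (step y z)
    show ?case
    proof (cases y)
      case (Inl u)
      then show ?thesis using step by (auto simp: GBM_simps)
    next
      case (Inr f)
      then obtain w where w: "z = Inl w" "(w, f) \<in> M" using step(2) by (auto simp: GBM_simps)
      obtain u where "u \<in> Vf f" "f \<in> F" "(v, u) \<in> edges\<^sup>*" "(u, f) \<notin> M" using step(3) Inr by auto
      moreover from this have "(u, w) \<in> edges" using w(2) unfolding constraint_edges_def by blast
      ultimately have "(v, w) \<in> edges\<^sup>*" by (metis rtrancl.rtrancl_into_rtrancl)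
      then show ?thesis using w by auto
    qed
  qed auto
  then show "(Inl v, Inl w) \<in> (GBM F Vf M)\<^sup>* \<Longrightarrow> (v, w) \<in> edges\<^sup>*" by blast
  show "(v, w) \<in> edges\<^sup>* \<Longrightarrow> (Inl v, Inl w) \<in> (GBM F Vf M)\<^sup>*"
  proof (induction rule: rtrancl_induct)
    case (step u w)
    then obtain f where "(Inl u, Inr f) \<in> GBM F Vf M" "(Inr f, Inl w) \<in> GBM F Vf M"
      unfolding constraint_edges_def by (auto simp: GBM_simps)
    with step(3) show ?case by (meson rtrancl.rtrancl_into_rtrancl)
  qed auto
qed

lemma scc_of_disjoint_W:
  assumes k: "k \<in> V - W" shows "scc_of V edges k \<inter> W = {}"
proof -
  have "w \<notin> W" if "(k, w) \<in> edges\<^sup>*" for w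
    using that by induction (use k edges_avoid_W in auto)
  then show ?thesis unfolding scc_of_def by auto
qed

text \<open>A variable in the scope of a constraint matched to \<open>v\<close> is \<open>v\<close>
  itself or, by definition, a parent of \<open>v\<close>. So the cluster involves only the component
  and its parents.\<close>

lemma cluster_scope:
  assumes k: "k \<in> V - W" and SF: "SF = {f. \<exists>v\<in>scc_of V edges k. (v, f) \<in> M}"
  shows "scc_of V edges k \<subseteq> VS Vf SF" "VS Vf SF \<subseteq> scc_family V edges k"
proof -
  show "scc_of V edges k \<subseteq> VS Vf SF"
  proof
    fix v assume v: "v \<in> scc_of V edges k"
    then obtain f where "(v, f) \<in> M"
      using match_exists[of v] scc_of_disjoint_W[OF k] unfolding scc_of_def by auto
    then show "v \<in> VS Vf SF" using v matchD(2) unfolding VS_def SF by auto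
  qed
  show "VS Vf SF \<subseteq> scc_family V edges k"
  proof
    fix u assume "u \<in> VS Vf SF"
    then obtain f v where f: "u \<in> Vf f" "v \<in> scc_of V edges k" "(v, f) \<in> M" unfolding VS_def SF by auto
    show "u \<in> scc_family V edges k"
    proof (cases "(u, f) \<in> M")
      case True
      then show ?thesis using match_unique[OF _ f(3)] f(2) unfolding scc_family_def by auto
    next
      case False
      then have "(u, v) \<in> edges" using f matchD(1)[OF f(3)] unfolding constraint_edges_def by auto
      then show ?thesis using f(2) unfolding scc_family_def by auto
    qed
  qed
qed

context
  fixes k S assumes k: "k \<in> V - W" and S: "S = scc_of (Gnodes V F) (GBM F Vf M) (Inl k)"
begin

lemma Inl_in_scc: "Inl v \<in> S \<longleftrightarrow> v \<in> scc_of V edges k"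
  unfolding S scc_of_def by (auto simp: GBM_reach Gnodes_def)

text \<open>The only edge out of a constraint leads to its matched variable, so the way back to
  \<open>k\<close> passes through that variable.\<close>

lemma Inr_in_scc:
  assumes "Inr f \<in> S" "(v, f) \<in> M" shows "v \<in> scc_of V edges k"
proof -
  have "(Inl k, Inr f) \<in> (GBM F Vf M)\<^sup>*" "(Inr f, Inl k) \<in> (GBM F Vf M)\<^sup>*"
    using assms(1) unfolding S scc_of_def by auto
  moreover have fv: "(Inr f, Inl v) \<in> GBM F Vf M" using assms(2) by (simp add: GBM_simps)
  moreover have "(Inl v, Inl k) \<in> (GBM F Vf M)\<^sup>*"
    using calculation(2)
  proof (cases rule: converse_rtranclE)
    case (step y)
    then obtain u where "y = Inl u" "(u, f) \<in> M" by (auto simp: GBM_simps)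
    then show ?thesis using step match_unique[OF assms(2)] by auto
  qed auto
  ultimately show ?thesis
    using matchD(3)[OF assms(2)] GBM_reach unfolding scc_of_def
    by (auto intro: rtrancl.rtrancl_into_rtrancl)
qed

text \<open>The matching adds no variable to such a component. It can add a constraint: if a
  variable lies on no cycle, its matched constraint is outside the component.\<close>

lemma cluster_variables: "{v. Inl v \<in> S \<union> matched M S} = scc_of V edges k"
  using Inl_in_scc Inr_in_scc unfolding matched_def by auto

lemma cluster_constraints: "{f. Inr f \<in> S \<union> matched M S} = {f. \<exists>v\<in>scc_of V edges k. (v, f) \<in> M}"
proof -
  have "\<exists>v. (v, f) \<in> M" if "Inr f \<in> S" for f
    using that match unfolding S scc_of_def Gnodes_def perfect_matching_induced_def by blast
  then show ?thesis using Inl_in_scc Inr_in_scc unfolding matched_def by blast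
qed

end

end

section \<open>From almost sure determination to the Markov property\<close>

lemma AE_eq_determined_set:
  assumes Xs: "Xs \<in> P \<rightarrow>\<^sub>M PiM V Xsp" and h: "h \<in> PiM R Xsp \<rightarrow>\<^sub>M PiM K Xsp"
    and P: "prob_space P"
    and eq: "AE \<omega> in P. restrict (Xs \<omega>) K = h (restrict (Xs \<omega>) R)"
    and sub: "K \<subseteq> G" "G \<subseteq> V" "R \<subseteq> G - K"
    and a: "a \<in> sets (coord_algebra (distr P (PiM V Xsp) Xs) Xsp G)"
  shows "\<exists>a0\<in>sets (coord_algebra (distr P (PiM V Xsp) Xs) Xsp (G - K)).
    AE x in distr P (PiM V Xsp) Xs. x \<in> a \<longleftrightarrow> x \<in> a0"
proof -
  let ?Q = "distr P (PiM V Xsp) Xs"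
  interpret coord_prob_space ?Q V Xsp
    by (intro coord_prob_space.intro coord_prob_space_axioms.intro prob_space.prob_space_distr[OF P Xs] sets_distr)
  obtain E where E: "E \<in> sets (PiM G Xsp)" "a = (\<lambda>x. restrict x G) -` E \<inter> space ?Q"
    using a sub by (auto simp: sets_coord)
  \<comment> \<open>Completes a point on \<open>G - K\<close> to one on \<open>G\<close> by
    computing the coordinates in \<open>K\<close> with \<open>h\<close>. Pulling \<open>E\<close>
    back along this map gives the event \<open>a0\<close>.\<close>
  define m where "m y = restrict (\<lambda>v. if v \<in> K then h (restrict y R) v else y v) G" for y
  have m: "m \<in> PiM (G - K) Xsp \<rightarrow>\<^sub>M PiM G Xsp"
    unfolding m_def
  proof (rule measurable_restrict)
    fix v assume v: "v \<in> G"
    show "(\<lambda>y. if v \<in> K then h (restrict y R) v else y v) \<in> PiM (G - K) Xsp \<rightarrow>\<^sub>M Xsp v"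
    proof (cases "v \<in> K")
      case True
      have "(\<lambda>y. h (restrict y R)) \<in> PiM (G - K) Xsp \<rightarrow>\<^sub>M PiM K Xsp"
        using measurable_compose[OF measurable_restrict_subset[OF sub(3)] h] .
      from measurable_compose[OF this measurable_component_singleton[OF True]] True
      show ?thesis by simp
    next
      case False
      then show ?thesis using v measurable_component_singleton[of v "G - K" Xsp] by simp
    qed
  qed
  define a0 where "a0 = (\<lambda>x. restrict x (G - K)) -` (m -` E \<inter> space (PiM (G - K) Xsp)) \<inter> space ?Q"
  have a0: "a0 \<in> sets (coord (G - K))"
    unfolding a0_def using sub by (intro vimage_in_coord measurable_sets[OF m E(1)]) auto
  have "restrict (Xs \<omega>) G = m (restrict (Xs \<omega>) (G - K))"
    if eq': "restrict (Xs \<omega>) K = h (restrict (Xs \<omega>) R)" for \<omega>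
  proof -
    have "restrict (restrict (Xs \<omega>) (G - K)) R = restrict (Xs \<omega>) R"
      using sub(3) by (simp add: Int_absorb1)
    moreover have "Xs \<omega> v = h (restrict (Xs \<omega>) R) v" if "v \<in> K" for v
      using fun_cong[OF eq', of v] that by simp
    ultimately show ?thesis unfolding m_def by (intro restrict_ext) auto
  qed
  note m_eq = this
  have sp: "restrict (Xs \<omega>) (G - K) \<in> space (PiM (G - K) Xsp)" "Xs \<omega> \<in> space (PiM V Xsp)"
    if "\<omega> \<in> space P" for \<omega>
    using measurable_space[OF Xs that] sub by (auto simp: space_PiM PiE_iff subset_eq)
  have "AE \<omega> in P. Xs \<omega> \<in> a \<longleftrightarrow> Xs \<omega> \<in> a0"
    using eq AE_space
  proof eventually_elim
    case (elim \<omega>)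
    then show ?case using m_eq[OF elim(1)] sp[OF elim(2)] by (simp add: a0_def E(2))
  qed
  moreover have "a \<in> events" "a0 \<in> events"
    using subalgebra_sets[OF subalgebra_coord a] subalgebra_sets[OF subalgebra_coord a0] sub by auto
  then have "{x \<in> space (PiM V Xsp). x \<in> a \<longleftrightarrow> x \<in> a0} \<in> sets (PiM V Xsp)" by auto
  ultimately have "AE x in ?Q. x \<in> a \<longleftrightarrow> x \<in> a0" by (simp only: AE_distr_iff[OF Xs])
  then show ?thesis using a0 by blast
qed

theorem theorem18:
  fixes P :: "'o measure" and Xsp :: "'v \<Rightarrow> 'a measure"
    and V W :: "'v set" and X :: "'v \<Rightarrow> 'o \<Rightarrow> 'a"
    and F :: "'f set" and Vf :: "'f \<Rightarrow> 'v set"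
    and phi :: "'f \<Rightarrow> ('v \<Rightarrow> 'a) \<Rightarrow> 'b" and c :: "'f \<Rightarrow> 'b" and Ysp :: "'b measure"
    and g :: "('v \<Rightarrow> 'a) \<Rightarrow> ('v \<Rightarrow> 'a)" and M :: "('v \<times> 'f) set"
  assumes sys: "system_of_constraints P Xsp V W X F Vf phi c Ysp"
    and sol: "is_solution P Xsp V W X F Vf phi c g"
    and match: "perfect_matching_induced V W F Vf M"
    and uniq: "\<And>S. is_scc (Gnodes V F) (GBM F Vf M) S \<Longrightarrow> S \<inter> Inl ` W = {} \<Longrightarrow>
                 uniquely_solvable P Xsp W X Vf phi c
                   {f. Inr f \<in> S \<union> matched M S} {v. Inl v \<in> S \<union> matched M S}"
  shows "gdgmp V
           (mar_dir (Gnodes V F) (GBM F Vf M) (Inr ` F))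
           (mar_bi (Gnodes V F) (GBM F Vf M) (Inr ` F))
           Xsp (distr P (PiM V Xsp) (Xstar V W X g))"
proof -
  let ?Xs = "Xstar V W X g"
  let ?Q = "distr P (PiM V Xsp) ?Xs"
  have fin: "finite V" and WV: "W \<subseteq> V" and P: "prob_space P"
    and ind: "prob_space.indep_vars P Xsp X W" and Vf: "\<And>f. f \<in> F \<Longrightarrow> Vf f \<subseteq> V"
    using sys unfolding system_of_constraints_def by auto
  have g: "g \<in> PiM W Xsp \<rightarrow>\<^sub>M PiM (V - W) Xsp"
    and solves: "AE \<omega> in P. \<forall>f\<in>F. phi f (combine W (g (XW W X \<omega>)) (XW W X \<omega>) (Vf f)) = c f"
    using sol unfolding is_solution_def by auto
  interpret P: prob_space P by (rule P)
  interpret matched_constraints V W F Vf M using match Vf by unfold_locales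
  have X_meas: "X w \<in> P \<rightarrow>\<^sub>M Xsp w" if "w \<in> W" for w
    using ind that unfolding P.indep_vars_def by auto
  have XW: "XW W X \<in> P \<rightarrow>\<^sub>M PiM W Xsp"
    unfolding XW_def by (intro measurable_restrict X_meas)
  have Xs: "?Xs \<in> P \<rightarrow>\<^sub>M PiM V Xsp"
    unfolding Xstar_def[abs_def] combine_def
  proof (rule measurable_restrict)
    fix v assume "v \<in> V"
    then show "(\<lambda>\<omega>. if v \<in> W then XW W X \<omega> v else g (XW W X \<omega>) v) \<in> P \<rightarrow>\<^sub>M Xsp v"
      using measurable_compose[OF XW measurable_component_singleton[of v W Xsp]]
        measurable_compose[OF measurable_compose[OF XW g] measurable_component_singleton[of v "V - W" Xsp]]
      by (cases "v \<in> W") auto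
  qed
  interpret Q: coord_prob_space ?Q V Xsp
    by (intro coord_prob_space.intro coord_prob_space_axioms.intro P.prob_space_distr[OF Xs] sets_distr)

  \<comment> \<open>On coordinates in \<open>W\<close> the vector \<open>?Xs\<close> is
    \<open>X\<close> itself, so independence of disjoint blocks of \<open>X\<close> carries over to
    its law.\<close>
  have indep: "Q.prob (a \<inter> b) = Q.prob a * Q.prob b"
    if ST: "S \<subseteq> W" "T \<subseteq> W" "S \<inter> T = {}" and ab: "a \<in> sets (Q.coord S)" "b \<in> sets (Q.coord T)"
    for S T a b
  proof -
    obtain E E' where E: "E \<in> sets (PiM S Xsp)" "a = (\<lambda>x. restrict x S) -` E \<inter> space ?Q"
      "E' \<in> sets (PiM T Xsp)" "b = (\<lambda>x. restrict x T) -` E' \<inter> space ?Q"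
      using ab unfolding Q.sets_coord[OF subset_trans[OF ST(1) WV]] Q.sets_coord[OF subset_trans[OF ST(2) WV]]
      by blast
    have restr: "restrict (?Xs \<omega>) R = restrict (\<lambda>w. X w \<omega>) R" if "R \<subseteq> W" for R \<omega>
      using that WV by (auto simp: Xstar_def combine_def XW_def fun_eq_iff)
    have vim: "?Xs -` ((\<lambda>x. restrict x R) -` A \<inter> space ?Q) \<inter> space P
      = (\<lambda>\<omega>. restrict (\<lambda>w. X w \<omega>) R) -` A \<inter> space P" if "R \<subseteq> W" for R A
      using measurable_space[OF Xs] by (auto simp: restr[OF that])
    have ev: "a \<in> Q.events" "b \<in> Q.events"
      using Q.subalgebra_sets[OF Q.subalgebra_coord ab(1)] Q.subalgebra_sets[OF Q.subalgebra_coord ab(2)] ST WV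
      by auto
    have d: "Q.prob e = P.prob (?Xs -` e \<inter> space P)" if "e \<in> Q.events" for e
      using measure_distr[OF Xs] that by auto
    have "?Xs -` (a \<inter> b) \<inter> space P = (?Xs -` a \<inter> space P) \<inter> (?Xs -` b \<inter> space P)" by auto
    also have "\<dots> = (\<lambda>\<omega>. (restrict (\<lambda>w. X w \<omega>) S, restrict (\<lambda>w. X w \<omega>) T)) -` (E \<times> E') \<inter> space P"
      unfolding E(2,4) vim[OF ST(1)] vim[OF ST(2)] by auto
    finally have "Q.prob (a \<inter> b) = P.prob \<dots>" using d[of "a \<inter> b"] ev by auto
    also have "\<dots> = P.prob (?Xs -` a \<inter> space P) * P.prob (?Xs -` b \<inter> space P)"
      unfolding E(2,4) vim[OF ST(1)] vim[OF ST(2)]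
      by (rule P.indep_varD[OF P.indep_var_restrict[OF ind ST(3,1,2)] E(1,3)])
    finally show ?thesis using d ev by auto
  qed

  \<comment> \<open>The solution satisfies all constraints of the cluster, so unique solvability
    expresses the component by \<open>gS\<close> in the other variables of the scope.\<close>
  have determined: "\<exists>a0\<in>sets (Q.coord (G - scc_of V edges k)). AE x in ?Q. x \<in> a \<longleftrightarrow> x \<in> a0"
    if k: "k \<in> V - W" and G: "scc_family V edges k \<subseteq> G" "G \<subseteq> V" and a: "a \<in> sets (Q.coord G)" for k G a
  proof -
    define S where "S = scc_of (Gnodes V F) (GBM F Vf M) (Inl k)"
    define K where "K = scc_of V edges k"
    define SF where "SF = {f. \<exists>v\<in>K. (v, f) \<in> M}"
    let ?R = "VS Vf SF - K"
    have KW: "K \<inter> W = {}" "K \<subseteq> G" using scc_of_disjoint_W[OF k] G(1) unfolding K_def scc_family_def by auto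
    have KV: "K \<subseteq> VS Vf SF" "VS Vf SF \<subseteq> G"
      using cluster_scope[OF k SF_def[unfolded K_def]] G(1) unfolding K_def by auto
    have SF: "SF \<subseteq> F" using matchD(1) unfolding SF_def by auto
    have "is_scc (Gnodes V F) (GBM F Vf M) S"
      using k unfolding is_scc_def S_def Gnodes_def by blast
    moreover have "S \<inter> Inl ` W = {}"
      using KW(1) Inl_in_scc[OF k S_def] unfolding K_def by auto
    ultimately have "uniquely_solvable P Xsp W X Vf phi c SF K"
      using uniq[of S] unfolding cluster_variables[OF k S_def] cluster_constraints[OF k S_def] SF_def K_def
      by simp
    then obtain gS where gS: "gS \<in> PiM ?R Xsp \<rightarrow>\<^sub>M PiM K Xsp"
      and AE: "AE xw in distr P (PiM W Xsp) (XW W X). \<forall>x \<in> space (PiM (VS Vf SF - W) Xsp).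
        (\<forall>f\<in>SF. phi f (combine W x xw (Vf f)) = c f) \<longleftrightarrow>
        restrict x K = gS (combine W (restrict x (VS Vf SF - (K \<union> W))) xw ?R)"
      unfolding uniquely_solvable_def by (elim bexE) (rule that)
    have "AE \<omega> in P. restrict (?Xs \<omega>) K = gS (restrict (?Xs \<omega>) ?R)"
      using AE_distrD[OF XW AE] solves AE_space
    proof eventually_elim
      case (elim \<omega>)
      \<comment> \<open>The exceptional null set of unique solvability is uniform in
        \<open>x\<close>, so \<open>x\<close> may be the random solution at the same
        \<open>\<omega>\<close>.\<close>
      let ?x = "restrict (?Xs \<omega>) (VS Vf SF - W)"
      have "?Xs \<omega> \<in> space (PiM V Xsp)" using measurable_space[OF Xs elim(3)] .
      then have x: "?x \<in> space (PiM (VS Vf SF - W) Xsp)"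
        using KV(2) G(2) by (auto simp: space_PiM PiE_iff subset_eq)
      have "combine W ?x (XW W X \<omega>) (Vf f) = combine W (g (XW W X \<omega>)) (XW W X \<omega>) (Vf f)" if "f \<in> SF" for f
      proof -
        have "Vf f \<subseteq> VS Vf SF" "Vf f \<subseteq> V" using that SF Vf unfolding VS_def by auto
        then show ?thesis unfolding combine_def Xstar_def by (auto simp: fun_eq_iff)
      qed
      then have "\<forall>f\<in>SF. phi f (combine W ?x (XW W X \<omega>) (Vf f)) = c f" using elim(2) SF by auto
      with elim(1) x have "restrict ?x K = gS (combine W (restrict ?x (VS Vf SF - (K \<union> W))) (XW W X \<omega>) ?R)"
        by blast
      moreover have "restrict ?x K = restrict (?Xs \<omega>) K" using KV(1) KW(1) by (auto simp: fun_eq_iff)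
      moreover have "combine W (restrict ?x (VS Vf SF - (K \<union> W))) (XW W X \<omega>) ?R = restrict (?Xs \<omega>) ?R"
        using KV(2) G(2) unfolding combine_def Xstar_def by (auto simp: fun_eq_iff)
      ultimately show ?case by simp
    qed
    from AE_eq_determined_set[OF Xs gS P this KW(2) G(2) _ a] show ?thesis
      using KV(2) unfolding K_def by auto
  qed

  show ?thesis
    unfolding gdgmp_def cond_indep_def coord_algebra_def[symmetric]
  proof (intro allI impI ballI; elim conjE)
    fix A B C A' B'
    assume ABC: "A \<subseteq> V" "B \<subseteq> V" "C \<subseteq> V"
      and sep: "sigma_separated (Inl ` V) (mar_dir (Gnodes V F) (GBM F Vf M) (Inr ` F))
        (mar_bi (Gnodes V F) (GBM F Vf M) (Inr ` F)) (Inl ` A) (Inl ` B) (Inl ` C)"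
      and AB': "A' \<in> sets (PiM A Xsp)" "B' \<in> sets (PiM B Xsp)"
    from sigma_separated_mar_cover[OF ABC sep] obtain G H where
      GH: "G \<inter> H = C" "A \<subseteq> G" "B \<subseteq> H" "G \<subseteq> V" "H \<subseteq> V"
      and cover: "\<And>k. k \<in> G \<union> H \<Longrightarrow> scc_family V edges k \<subseteq> G \<or> scc_family V edges k \<subseteq> H" by blast
    \<comment> \<open>Independence is shown for the whole sides of the cover; events of
      \<open>A\<close> and \<open>B\<close> are then special events of \<open>G\<close> and
      \<open>H\<close>.\<close>
    have "indep_given ?Q (Q.coord (G \<inter> H)) (Q.coord G) (Q.coord H)"
    proof (rule Q.indep_given_of_cover[OF fin edges_subset _ _ _ GH(4,5)])
      show "w \<notin> W" if "(v, w) \<in> edges" for v w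
        using that by (rule edges_avoid_W)
      show "Q.prob (a \<inter> b) = Q.prob a * Q.prob b"
        if "S \<subseteq> W" "T \<subseteq> W" "S \<inter> T = {}" "a \<in> sets (Q.coord S)" "b \<in> sets (Q.coord T)" for S T a b
        using that by (rule indep)
      show "\<exists>a0\<in>sets (Q.coord (G - scc_of V edges k)). AE x in ?Q. x \<in> a \<longleftrightarrow> x \<in> a0"
        if "k \<in> V - W" "scc_family V edges k \<subseteq> G" "G \<subseteq> V" "a \<in> sets (Q.coord G)" for k G a
        using that by (rule determined)
    qed (rule cover, simp)
    then have indep_given: "indep_given ?Q (Q.coord C) (Q.coord G) (Q.coord H)" using GH(1) by simp
    show "AE \<omega> in ?Q. real_cond_exp ?Q (Q.coord C)
        (indicator (((\<lambda>x. restrict x A) -` A' \<inter> space ?Q) \<inter> ((\<lambda>x. restrict x B) -` B' \<inter> space ?Q))) \<omega>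
      = real_cond_exp ?Q (Q.coord C) (indicator ((\<lambda>x. restrict x A) -` A' \<inter> space ?Q)) \<omega>
      * real_cond_exp ?Q (Q.coord C) (indicator ((\<lambda>x. restrict x B) -` B' \<inter> space ?Q)) \<omega>"
    proof (rule Q.indep_given_imp_cond_exp_product[OF _ _ _ _ indep_given])
      show "(\<lambda>x. restrict x A) -` A' \<inter> space ?Q \<in> sets (Q.coord G)"
        using Q.vimage_in_coord[OF ABC(1) AB'(1)] Q.sets_coord_mono[OF GH(2,4)] by blast
      show "(\<lambda>x. restrict x B) -` B' \<inter> space ?Q \<in> sets (Q.coord H)"
        using Q.vimage_in_coord[OF ABC(2) AB'(2)] Q.sets_coord_mono[OF GH(3,5)] by blast
      show "sets (Q.coord C) \<subseteq> sets (Q.coord G)" using GH by (intro Q.sets_coord_mono) auto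
    qed (use ABC GH in \<open>auto intro!: Q.subalgebra_coord\<close>)
  qed
qed

end
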